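(* Let $G=\mathrm{GIRG}(n,\beta,w_0,d)$ be a standard GIRG with $\beta>3$ and $d=\omega(\log n)$. Then $\mathbb{E}[K_k]=o(1)$ for $k\ge4$, and hence $\omega(G)\le3$ asymptotically almost surely.
   Context: Fix constants $\lambda>0$, $w_0>0$, $\beta>2$. A standard GIRG $\mathrm{GIRG}(n,\beta,w_0,d)$ has $n$ vertices; each vertex $v$ independently receives a weight $w_v$ with $\Pr[w_v\le x]=1-(x/w_0)^{1-\beta}$ for $x\ge w_0$, and independently a position $\mathbf{x}_v$ uniform on the torus $\mathbb{T}^d=[0,1)^d$. The distance is $d(\mathbf{x}_u,\mathbf{x}_v)=\max_{1\le i\le d}|x_{ui}-x_{vi}|_C$ with $|a-b|_C=\min\{|a-b|,1-|a-b|\}$. Distinct $u,v$ are adjacent iff $d(\mathbf{x}_u,\mathbf{x}_v)\le \frac12\big(\frac{\lambda w_uw_v}{n}\big)^{1/d}$. The dimension $d=d(n)$ depends on $n$; asymptotics are as $n\to\infty$. $K_k$ is the number of $k$-cliques and $\omega(G)$ the clique number; "asymptotically almost surely" means with probability $1-o(1)$. *)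

theory Defs
  imports "HOL-Probability.Probability" "HOL-Library.Landau_Symbols" "HOL-Library.Ramsey"
begin

definition weight_cdf :: "real \<Rightarrow> real \<Rightarrow> real \<Rightarrow> real" where
  "weight_cdf \<beta> w0 x = (if x < w0 then 0 else 1 - (x / w0) powr (1 - \<beta>))"

definition weight_measure :: "real \<Rightarrow> real \<Rightarrow> real measure" where
  "weight_measure \<beta> w0 = interval_measure (weight_cdf \<beta> w0)"

text \<open>Since the dimension varies with the number of vertices, points of the torus are functions
  on the index set \<open>{..<d}\<close> rather than elements of a Cartesian-power type.\<close>

definition torus_measure :: "nat \<Rightarrow> (nat \<Rightarrow> real) measure" where
  "torus_measure d = PiM {..<d} (\<lambda>_. uniform_measure lborel {0..<1})"

definition circle_dist :: "real \<Rightarrow> real \<Rightarrow> real" where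
  "circle_dist a b = min \<bar>a - b\<bar> (1 - \<bar>a - b\<bar>)"

definition torus_dist :: "nat \<Rightarrow> (nat \<Rightarrow> real) \<Rightarrow> (nat \<Rightarrow> real) \<Rightarrow> real" where
  "torus_dist d x y = Max ((\<lambda>i. circle_dist (x i) (y i)) ` {..<d})"

text \<open>A sample point assigns to each vertex \<open>v < n\<close> the pair of its weight and its position.\<close>

type_synonym girg_sample = "nat \<Rightarrow> real \<times> (nat \<Rightarrow> real)"

definition girg_measure :: "nat \<Rightarrow> real \<Rightarrow> real \<Rightarrow> nat \<Rightarrow> girg_sample measure" where
  "girg_measure n \<beta> w0 d = PiM {..<n} (\<lambda>_. weight_measure \<beta> w0 \<Otimes>\<^sub>M torus_measure d)"

definition girg_adj :: "real \<Rightarrow> nat \<Rightarrow> nat \<Rightarrow> girg_sample \<Rightarrow> nat \<Rightarrow> nat \<Rightarrow> bool" where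
  "girg_adj lam n d g u v \<longleftrightarrow> u \<noteq> v \<and>
     torus_dist d (snd (g u)) (snd (g v))
       \<le> 1 / 2 * (lam * fst (g u) * fst (g v) / real n) powr (1 / real d)"

definition girg_edges :: "real \<Rightarrow> nat \<Rightarrow> nat \<Rightarrow> girg_sample \<Rightarrow> nat set set" where
  "girg_edges lam n d g = {{u, v} | u v. u < n \<and> v < n \<and> girg_adj lam n d g u v}"

definition num_cliques :: "'a set \<Rightarrow> 'a set set \<Rightarrow> nat \<Rightarrow> nat" where
  "num_cliques V E k = card {S. S \<subseteq> V \<and> card S = k \<and> clique S E}"

definition clique_number :: "'a set \<Rightarrow> 'a set set \<Rightarrow> nat" where
  "clique_number V E = Max (card ` {S. S \<subseteq> V \<and> clique S E})"


text \<open>The model is a genuine probability space with the intended weight distribution, and the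
  quantities of interest are measurable, so that expectations and probabilities of them are not
  junk values.\<close>

lemma weight_cdf_max:
  assumes "w0 > 0"
  shows "weight_cdf \<beta> w0 x = 1 - (max x w0 / w0) powr (1 - \<beta>)"
  using assms by (auto simp: weight_cdf_def max_def)

lemma weight_cdf_props:
  assumes "w0 > 0" "\<beta> > 1"
  shows "x \<le> y \<Longrightarrow> weight_cdf \<beta> w0 x \<le> weight_cdf \<beta> w0 y"
    and "continuous (at_right a) (weight_cdf \<beta> w0)"
    and "(weight_cdf \<beta> w0 \<longlongrightarrow> 0) at_bot"
    and "(weight_cdf \<beta> w0 \<longlongrightarrow> 1) at_top"
proof -
  show "weight_cdf \<beta> w0 x \<le> weight_cdf \<beta> w0 y" if "x \<le> y"
    unfolding weight_cdf_max[OF assms(1)] using assms that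
    by (intro diff_left_mono powr_mono2' divide_right_mono divide_pos_pos) auto
  have "continuous_on UNIV (weight_cdf \<beta> w0)"
    unfolding weight_cdf_max[OF assms(1), abs_def] using assms
    by (intro continuous_intros) (auto simp: max_def)
  then show "continuous (at_right a) (weight_cdf \<beta> w0)"
    by (auto simp: continuous_on_eq_continuous_at intro: continuous_at_imp_continuous_at_within)
  show "(weight_cdf \<beta> w0 \<longlongrightarrow> 0) at_bot"
    by (rule tendsto_eventually)
       (auto simp: weight_cdf_def eventually_at_bot_dense intro!: exI[of _ w0])
  have "((\<lambda>x. (x / w0) powr (1 - \<beta>)) \<longlongrightarrow> 0) at_top"
    using assms
    by (intro tendsto_neg_powr filterlim_at_top_mult_tendsto_pos[OF tendsto_const, of "1 / w0" "\<lambda>x. x", simplified] filterlim_ident)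
       auto
  then have "((\<lambda>x. 1 - (x / w0) powr (1 - \<beta>)) \<longlongrightarrow> 1 - 0) at_top"
    by (intro tendsto_diff tendsto_const)
  moreover have "eventually (\<lambda>x. 1 - (x / w0) powr (1 - \<beta>) = weight_cdf \<beta> w0 x) at_top"
    using eventually_ge_at_top[of w0] by eventually_elim (auto simp: weight_cdf_def)
  ultimately show "(weight_cdf \<beta> w0 \<longlongrightarrow> 1) at_top"
    by (auto intro: Lim_transform_eventually)
qed

lemma prob_space_weight_measure:
  assumes "w0 > 0" "\<beta> > 1"
  shows "prob_space (weight_measure \<beta> w0)"
  unfolding weight_measure_def
  by (rule real_distribution.axioms(1)
        [OF real_distribution_interval_measure[OF weight_cdf_props[OF assms]]])

lemma measure_weight_measure_Iic:
  assumes "w0 > 0" "\<beta> > 1" "x \<ge> w0"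
  shows "measure (weight_measure \<beta> w0) {..x} = 1 - (x / w0) powr (1 - \<beta>)"
  unfolding weight_measure_def
  using measure_interval_measure_Iic[OF weight_cdf_props(1-3)[OF assms(1,2)]] assms(3)
  by (simp add: weight_cdf_def)

lemma prob_space_torus_measure: "prob_space (torus_measure d)"
  unfolding torus_measure_def
  by (intro prob_space_PiM prob_space_uniform_measure) auto

lemma prob_space_girg_measure:
  assumes "w0 > 0" "\<beta> > 1"
  shows "prob_space (girg_measure n \<beta> w0 d)"
proof -
  interpret W: prob_space "weight_measure \<beta> w0"
    by (rule prob_space_weight_measure[OF assms])
  interpret T: prob_space "torus_measure d"
    by (rule prob_space_torus_measure)
  interpret pair_prob_space "weight_measure \<beta> w0" "torus_measure d" ..
  show ?thesis
    unfolding girg_measure_def by (intro prob_space_PiM prob_space_axioms)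
qed

lemma girg_adj_commute: "girg_adj lam n d g u v \<longleftrightarrow> girg_adj lam n d g v u"
proof -
  have c: "circle_dist a b = circle_dist b a" for a b
    unfolding circle_dist_def by (simp only: abs_minus_commute[of a b])
  have t: "torus_dist d (snd (g u)) (snd (g v)) = torus_dist d (snd (g v)) (snd (g u))"
    unfolding torus_dist_def by (subst c) (rule refl)
  have w: "lam * fst (g u) * fst (g v) = lam * fst (g v) * fst (g u)"
    by simp
  show ?thesis
    unfolding girg_adj_def t w by blast
qed

lemma clique_girg_edges:
  assumes "S \<subseteq> {..<n}"
  shows "clique S (girg_edges lam n d g) \<longleftrightarrow> (\<forall>u\<in>S. \<forall>v\<in>S. u \<noteq> v \<longrightarrow> girg_adj lam n d g u v)"
proof -
  have "{u, v} \<in> girg_edges lam n d g \<longleftrightarrow> girg_adj lam n d g u v" if "u \<in> S" "v \<in> S" for u v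
    using that assms girg_adj_commute[of lam n d g u v]
    unfolding girg_edges_def doubleton_eq_iff mem_Collect_eq by blast
  then show ?thesis unfolding clique_def by blast
qed

lemma pred_girg_adj:
  assumes "u < n" "v < n"
  shows "Measurable.pred (girg_measure n \<beta> w0 d) (\<lambda>g. girg_adj lam n d g u v)"
proof -
  let ?M = "girg_measure n \<beta> w0 d"
  have comp: "(\<lambda>g. g w) \<in> ?M \<rightarrow>\<^sub>M weight_measure \<beta> w0 \<Otimes>\<^sub>M torus_measure d" if "w < n" for w
    unfolding girg_measure_def using that by (intro measurable_component_singleton) auto
  have wt: "(\<lambda>g. fst (g w)) \<in> borel_measurable ?M" if "w < n" for w
  proof -
    have sb: "sets (weight_measure \<beta> w0) = sets borel" by (simp add: weight_measure_def)
    from measurable_compose[OF comp[OF that] measurable_fst] show ?thesis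
      unfolding measurable_cong_sets[OF refl sb] .
  qed
  have pos: "(\<lambda>g. snd (g w) i) \<in> borel_measurable ?M" if "w < n" "i < d" for w i
  proof -
    have "(\<lambda>x. x i) \<in> torus_measure d \<rightarrow>\<^sub>M uniform_measure lborel {0..<1}"
      unfolding torus_measure_def using that by (intro measurable_component_singleton) auto
    moreover have su: "sets (uniform_measure lborel {0..<1::real}) = sets borel" by simp
    ultimately have "(\<lambda>x. x i) \<in> borel_measurable (torus_measure d)"
      by (simp only: measurable_cong_sets[OF refl su])
    from measurable_compose[OF measurable_compose[OF comp[OF that(1)] measurable_snd] this]
    show ?thesis .
  qed
  have cd: "(\<lambda>g. circle_dist (snd (g u) i) (snd (g v) i)) \<in> borel_measurable ?M" if "i < d" for i
    unfolding circle_dist_def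
    using assms that
    by (intro borel_measurable_min borel_measurable_abs borel_measurable_diff
          borel_measurable_const pos)
  have td: "(\<lambda>g. torus_dist d (snd (g u)) (snd (g v))) \<in> borel_measurable ?M"
  proof (cases "d = 0")
    case True
    then show ?thesis by (simp add: torus_dist_def)
  next
    case False
    then show ?thesis
      unfolding torus_dist_def
      by (intro borel_measurable_Max finite_lessThan cd) simp
  qed
  have "(\<lambda>g. 1 / 2 * (lam * fst (g u) * fst (g v) / real n) powr (1 / real d))
      \<in> borel_measurable ?M"
    using assms
    by (intro borel_measurable_times borel_measurable_divide powr_real_measurable
          borel_measurable_const wt)
  from borel_measurable_le[OF td this] show ?thesis
    unfolding girg_adj_def by (intro pred_intros_conj1') (simp only: pred_def)
qed

lemma pred_girg_clique:
  assumes "S \<subseteq> {..<n}"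
  shows "Measurable.pred (girg_measure n \<beta> w0 d) (\<lambda>g. clique S (girg_edges lam n d g))"
proof -
  have "finite S" using assms finite_subset by blast
  then show ?thesis
    unfolding clique_girg_edges[OF assms] using assms
    by (intro pred_intros_finite(3) pred_intros_imp' pred_girg_adj) auto
qed

lemma measurable_num_cliques:
  "(\<lambda>g. real (num_cliques {..<n} (girg_edges lam n d g) k))
     \<in> borel_measurable (girg_measure n \<beta> w0 d)"
proof -
  let ?A = "{S. S \<subseteq> {..<n} \<and> card S = k}"
  have "finite ?A" by simp
  have "real (num_cliques {..<n} (girg_edges lam n d g) k)
      = (\<Sum>S\<in>?A. if clique S (girg_edges lam n d g) then 1 else 0)" for g
  proof -
    have "{S. S \<subseteq> {..<n} \<and> card S = k \<and> clique S (girg_edges lam n d g)}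
        = ?A \<inter> {S. clique S (girg_edges lam n d g)}" by auto
    then show ?thesis
      using \<open>finite ?A\<close> by (simp add: num_cliques_def sum.If_cases)
  qed
  moreover have "(\<lambda>g. \<Sum>S\<in>?A. if clique S (girg_edges lam n d g) then 1 else 0 :: real)
      \<in> borel_measurable (girg_measure n \<beta> w0 d)"
    by (intro borel_measurable_sum measurable_If pred_girg_clique[unfolded pred_def] measurable_const) auto
  ultimately show ?thesis by simp
qed

lemma integrable_num_cliques:
  assumes "w0 > 0" "\<beta> > 1"
  shows "integrable (girg_measure n \<beta> w0 d)
           (\<lambda>g. real (num_cliques {..<n} (girg_edges lam n d g) k))"
proof -
  interpret prob_space "girg_measure n \<beta> w0 d"
    by (rule prob_space_girg_measure[OF assms])
  have "num_cliques {..<n} E k \<le> card (Pow {..<n})" for E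
    unfolding num_cliques_def by (intro card_mono) auto
  then show ?thesis
    by (intro integrable_const_bound[where B = "real (card (Pow {..<n}))"] measurable_num_cliques)
       (intro AE_I2, simp only: real_norm_def abs_of_nat of_nat_le_iff)
qed

lemma sets_clique_number_le:
  "{g \<in> space (girg_measure n \<beta> w0 d). clique_number {..<n} (girg_edges lam n d g) \<le> m}
     \<in> sets (girg_measure n \<beta> w0 d)"
proof -
  have "clique_number {..<n} E \<le> m \<longleftrightarrow> (\<forall>S\<in>Pow {..<n}. clique S E \<longrightarrow> card S \<le> m)" for E
  proof -
    have "finite {S. S \<subseteq> {..<n} \<and> clique S E}"
      by (rule finite_subset[of _ "Pow {..<n}"]) auto
    moreover have "{} \<in> {S. S \<subseteq> {..<n} \<and> clique S E}" by simp
    ultimately show ?thesis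
      unfolding clique_number_def by (subst Max_le_iff) auto
  qed
  moreover have "Measurable.pred (girg_measure n \<beta> w0 d)
      (\<lambda>g. \<forall>S\<in>Pow {..<n}. clique S (girg_edges lam n d g) \<longrightarrow> card S \<le> m)"
    by (intro pred_intros_finite(3) pred_intros_logic(4) pred_girg_clique) auto
  ultimately show ?thesis by (simp add: pred_def)
qed

end

theory Submission
  imports Defs
begin

text \<open>
  Fix the weights and put \<open>\<kappa>\<^sub>u\<^sub>v = \<lambda> w\<^sub>u w\<^sub>v / n\<close>. In a single dimension the events that a pair of vertices
  is too far apart are pairwise independent, even for pairs that share a vertex, since the circle is
  rotation invariant; their probabilities are \<open>1 - exp (- \<delta>\<^sub>u\<^sub>v)\<close> with \<open>\<delta>\<^sub>u\<^sub>v = - ln (min 1 \<kappa>\<^sub>u\<^sub>v) / d\<close>. As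
  \<open>\<kappa>\<^sub>u\<^sub>v\<close> is at least of order \<open>1 / n\<close>, the hypothesis on \<open>d\<close> makes all \<open>\<delta>\<^sub>u\<^sub>v\<close> uniformly small, so the
  second Bonferroni inequality bounds the probability that no pair is too far apart by
  \<open>exp (- s \<Sum> \<delta>\<^sub>u\<^sub>v)\<close> for any fixed \<open>s < 1\<close> and large \<open>n\<close>. The dimensions are independent, so a
  \<open>k\<close>-set is a clique with conditional probability at most \<open>\<Prod> \<kappa>\<^sub>u\<^sub>v powr s\<close>. With \<open>s (k - 1) = 2 + \<epsilon>\<close>,
  where \<open>2 + \<epsilon> < \<beta> - 1\<close>, the corresponding weight moment is finite, and summing over all \<open>k\<close>-sets
  gives an expected number of cliques of order \<open>n powr (- k \<epsilon> / 2)\<close>. The statement on the clique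
  number is Markov's inequality for the number of 4-cliques.
\<close>

subsection \<open>A Bonferroni bound for pairwise independent events\<close>

text \<open>Integrate a quadratic in the number X of occurring events that dominates the indicator
  of X = 0. Only the second moment of X enters, so pairwise independence is enough: the moment is at
  most \<open>m\<^sup>2 + m\<close>, and 1 - 3 m / 2 + (m^2 + m) / 2 is the claimed bound.\<close>

lemma (in prob_space) prob_no_event_le:
  assumes fin: "finite E" and ev: "\<And>e. e \<in> E \<Longrightarrow> A e \<in> events"
    and indep: "\<And>e f. e \<in> E \<Longrightarrow> f \<in> E \<Longrightarrow> e \<noteq> f \<Longrightarrow> prob (A e \<inter> A f) = prob (A e) * prob (A f)"
  defines "m \<equiv> (\<Sum>e\<in>E. prob (A e))"
  shows "prob (space M - (\<Union>e\<in>E. A e)) \<le> 1 - m + m\<^sup>2 / 2"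
proof -
  define X where "X x = (\<Sum>e\<in>E. indicator (A e) x :: real)" for x
  have X_card: "X x = real (card {e \<in> E. x \<in> A e})" for x
    using fin by (simp add: X_def indicator_def sum.If_cases Int_def)
  have pointwise: "indicator (space M - (\<Union>e\<in>E. A e)) x \<le> 1 - 3 / 2 * X x + 1 / 2 * (X x)\<^sup>2" for x
  proof (cases "\<exists>e\<in>E. x \<in> A e")
    case True
    \<comment> \<open>A natural number \<open>X\<close> satisfies \<open>1[X = 0] \<le> (X - 1) (X - 2) / 2\<close>.\<close>
    have "(c - 1) * (c - 2) \<ge> (0::int)" for c
      by (cases "c \<le> 1") (auto simp: mult_nonpos_nonpos)
    from this[of "int (card {e \<in> E. x \<in> A e})"] have "(X x - 1) * (X x - 2) \<ge> 0"
      unfolding X_card by (metis (mono_tags) of_int_0_le_iff of_int_1 of_int_diff of_int_mult of_int_numeral of_int_of_nat_eq)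
    then show ?thesis using True by (auto simp: algebra_simps power2_eq_square)
  next
    case False
    then have "X x = 0" by (auto simp: X_def indicator_def)
    then show ?thesis by (auto simp: indicator_def)
  qed
  have sq: "(X x)\<^sup>2 = (\<Sum>e\<in>E. \<Sum>f\<in>E. indicator (A e \<inter> A f) x)" for x
    by (simp add: X_def power2_eq_square sum_product indicator_inter_arith)
  have int1: "integrable M (\<lambda>x. indicator (A e) x :: real)" if "e \<in> E" for e
    using ev[OF that] by (simp add: emeasure_eq_measure)
  have int2: "integrable M (\<lambda>x. indicator (A e \<inter> A f) x :: real)" if "e \<in> E" "f \<in> E" for e f
    using ev that by (simp add: emeasure_eq_measure)
  have intX: "integrable M X" unfolding X_def[abs_def] using int1 by (intro Bochner_Integration.integrable_sum)
  have intX2: "integrable M (\<lambda>x. (X x)\<^sup>2)"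
    unfolding sq using int2 by (intro Bochner_Integration.integrable_sum)
  have "prob (space M - (\<Union>e\<in>E. A e)) = (\<integral>x. indicator (space M - (\<Union>e\<in>E. A e)) x \<partial>M)"
    by (simp add: Int_absorb2)
  also have "\<dots> \<le> (\<integral>x. 1 - 3 / 2 * X x + 1 / 2 * (X x)\<^sup>2 \<partial>M)"
    using fin ev
    by (intro integral_mono pointwise Bochner_Integration.integrable_add
          Bochner_Integration.integrable_diff integrable_mult_right intX intX2
          integrable_real_indicator)
       (auto simp: emeasure_eq_measure)
  also have "\<dots> = 1 - 3 / 2 * (\<integral>x. X x \<partial>M) + 1 / 2 * (\<integral>x. (X x)\<^sup>2 \<partial>M)"
    using intX intX2 by (simp add: prob_space)
  also have "(\<integral>x. X x \<partial>M) = m"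
    unfolding X_def m_def using int1 ev
    by (subst Bochner_Integration.integral_sum) (auto intro!: sum.cong simp: Int_absorb2 sets.sets_into_space)
  also have "(\<integral>x. (X x)\<^sup>2 \<partial>M) = (\<Sum>e\<in>E. \<Sum>f\<in>E. prob (A e \<inter> A f))"
  proof -
    have "(\<integral>x. (X x)\<^sup>2 \<partial>M) = (\<Sum>e\<in>E. \<integral>x. (\<Sum>f\<in>E. indicator (A e \<inter> A f) x) \<partial>M)"
      unfolding sq using int2
      by (intro Bochner_Integration.integral_sum Bochner_Integration.integrable_sum)
    also have "\<dots> = (\<Sum>e\<in>E. \<Sum>f\<in>E. \<integral>x. indicator (A e \<inter> A f) x \<partial>M)"
      using int2 by (intro sum.cong refl Bochner_Integration.integral_sum)
    also have "\<dots> = (\<Sum>e\<in>E. \<Sum>f\<in>E. prob (A e \<inter> A f))"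
      using ev by (intro sum.cong refl) (simp add: Int_absorb2 sets.sets_into_space le_infI1)
    finally show ?thesis .
  qed
  \<comment> \<open>On the diagonal the product is added to the true value
    \<open>prob (A e)\<close>; this completes the products to a full double sum, which factors as
    \<open>m\<^sup>2\<close>.\<close>
  also have "\<dots> \<le> (\<Sum>e\<in>E. \<Sum>f\<in>E. prob (A e) * prob (A f) + (if e = f then prob (A e) else 0))"
    by (intro sum_mono) (auto simp: indep)
  also have "\<dots> = m\<^sup>2 + m"
    using fin by (simp add: sum.distrib m_def power2_eq_square sum_product)
  finally show ?thesis by (simp add: algebra_simps)
qed

subsection \<open>Distances on the circle\<close>

abbreviation unit_uniform :: "real measure" where
  "unit_uniform \<equiv> uniform_measure lborel {0..<1}"

lemma prob_space_unit_uniform: "prob_space unit_uniform"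
  by (intro prob_space_uniform_measure) auto

text \<open>The set is the open arc of length 1 - 2 t opposite to \<open>b\<close>. Cut at 0, it
  becomes at most two intervals in [0, 1), whose lengths add up to 1 - 2 t, or to 0 once t is at
  least 1/2. The value is free of \<open>b\<close>, which is the source of the pairwise independence
  below.\<close>

lemma emeasure_circle_dist_gt:
  assumes t: "t \<ge> 0" and b: "0 \<le> b" "b < 1"
  shows "emeasure unit_uniform {a. circle_dist a b > t} = ennreal (max 0 (1 - 2 * t))"
proof -
  have [measurable]: "{a. circle_dist a b > t} \<in> sets borel"
    unfolding circle_dist_def by measurable
  have "emeasure unit_uniform {a. circle_dist a b > t} = emeasure lborel ({0..<1} \<inter> {a. circle_dist a b > t})"
    by (simp add: divide_ennreal_def)
  also have "{0..<1} \<inter> {a. circle_dist a b > t} = 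
     ({b + t<..<b + 1 - t} \<inter> {0..<1}) \<union> ({b - 1 + t<..<b - t} \<inter> {0..<1})"
    using t b by (auto simp: circle_dist_def)
  also have "emeasure lborel \<dots> = emeasure lborel ({b + t<..<b + 1 - t} \<inter> {0..<1}) + emeasure lborel ({b - 1 + t<..<b - t} \<inter> {0..<1})"
    using t by (intro plus_emeasure[symmetric]) auto
  also have "emeasure lborel ({b + t<..<b + 1 - t} \<inter> {0..<1}) = ennreal (max 0 (min 1 (b + 1 - t) - (b + t)))"
  proof -
    have "{b + t<..<b + 1 - t} \<inter> {0..<1} = {b + t<..<min 1 (b + 1 - t)}"
      using t b by auto
    then show ?thesis by (cases "b + t \<le> min 1 (b + 1 - t)") (auto simp: ennreal_neg min_def max_def)
  qed
  also have "emeasure lborel ({b - 1 + t<..<b - t} \<inter> {0..<1}) = ennreal (max 0 (b - t - max 0 (b - 1 + t)))"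
  proof -
    have "emeasure lborel ({b - 1 + t<..<b - t} \<inter> {0..<1}) = emeasure lborel {max 0 (b - 1 + t)<..<b - t}"
    proof (rule emeasure_eq_AE)
      \<comment> \<open>The two sets can differ only in the point 0, which the half-open unit
        interval contains.\<close>
      show "AE x in lborel. (x \<in> {b - 1 + t<..<b - t} \<inter> {0..<1}) = (x \<in> {max 0 (b - 1 + t)<..<b - t})"
        using AE_lborel_singleton[of "0::real"] by eventually_elim (use t b in auto)
    qed auto
    then show ?thesis by (cases "max 0 (b - 1 + t) \<le> b - t") (auto simp: ennreal_neg max_def)
  qed
  also have "ennreal (max 0 (min 1 (b + 1 - t) - (b + t))) + ennreal (max 0 (b - t - max 0 (b - 1 + t)))
     = ennreal (max 0 (1 - 2 * t))"
  proof -
    have "max 0 (min 1 (b + 1 - t) - (b + t)) + max 0 (b - t - max 0 (b - 1 + t)) = max 0 (1 - 2 * t)"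
      using t b by auto
    then show ?thesis by (metis ennreal_plus max.cobounded1)
  qed
  finally show ?thesis .
qed

lemma circle_dist_commute: "circle_dist a b = circle_dist b a"
  by (simp add: circle_dist_def abs_minus_commute)

lemma borel_measurable_circle_dist [measurable]:
  assumes [measurable]: "f \<in> borel_measurable M" "g \<in> borel_measurable M"
  shows "(\<lambda>x. circle_dist (f x) (g x)) \<in> borel_measurable M"
  unfolding circle_dist_def by measurable

lemma AE_unit_uniform: "AE x in unit_uniform. x \<in> {0..<1}"
  by (rule AE_uniform_measureI) auto

lemma borel_measurable_PiM_unit_uniform:
  assumes "w \<in> I"
  shows "(\<lambda>x. x w) \<in> borel_measurable (PiM I (\<lambda>_. unit_uniform))"
  using measurable_component_singleton[OF assms, of "\<lambda>_. unit_uniform"]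
  unfolding measurable_cong_sets[OF refl, of unit_uniform borel, simplified] .

text \<open>Integrate out coordinate \<open>u\<close> first. Neither \<open>F\<close> nor
  \<open>x v\<close> depends on it, and by rotation invariance the inner integral has the same value
  for every \<open>x v\<close> in [0, 1), hence almost everywhere.\<close>

lemma nn_integral_PiM_circle_dist_gt:
  assumes I: "finite I" "u \<in> I" "v \<in> I" "u \<noteq> v" and t: "t \<ge> 0"
    and F [measurable]: "F \<in> borel_measurable (PiM I (\<lambda>_. unit_uniform))"
    and F_indep: "\<And>x a. F (x(u := a)) = F x"
  shows "(\<integral>\<^sup>+x. F x * indicator {x. circle_dist (x u) (x v) > t} x \<partial>PiM I (\<lambda>_. unit_uniform))
    = ennreal (max 0 (1 - 2 * t)) * (\<integral>\<^sup>+x. F x \<partial>PiM I (\<lambda>_. unit_uniform))"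
proof -
  interpret U: prob_space unit_uniform by (rule prob_space_unit_uniform)
  interpret product_prob_space "\<lambda>_. unit_uniform" I by unfold_locales
  let ?J = "I - {u}"
  interpret J: prob_space "PiM ?J (\<lambda>_. unit_uniform)"
    by (intro prob_space_PiM prob_space_unit_uniform)
  have I_eq: "insert u ?J = I" using I by auto
  note fubini = product_nn_integral_insert[of ?J u, unfolded I_eq]
  note [measurable] = borel_measurable_PiM_unit_uniform[OF I(2)] borel_measurable_PiM_unit_uniform[OF I(3)]
  define c where "c = ennreal (max 0 (1 - 2 * t))"
  have "(\<integral>\<^sup>+x. F x * indicator {x. circle_dist (x u) (x v) > t} x \<partial>PiM I (\<lambda>_. unit_uniform))
      = (\<integral>\<^sup>+x. (\<integral>\<^sup>+y. F (x(u := y)) * indicator {x. circle_dist (x u) (x v) > t} (x(u := y)) \<partial>unit_uniform) \<partial>PiM ?J (\<lambda>_. unit_uniform))"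
    using I(1) by (intro fubini) simp_all
  also have "\<dots> = (\<integral>\<^sup>+x. (\<integral>\<^sup>+y. F x * indicator {a. circle_dist a (x v) > t} y \<partial>unit_uniform) \<partial>PiM ?J (\<lambda>_. unit_uniform))"
    using I by (intro nn_integral_cong) (auto simp: F_indep indicator_def)
  also have "\<dots> = (\<integral>\<^sup>+x. F x * emeasure unit_uniform {a. circle_dist a (x v) > t} \<partial>PiM ?J (\<lambda>_. unit_uniform))"
    by (intro nn_integral_cong, subst nn_integral_cmult_indicator) auto
  also have "\<dots> = (\<integral>\<^sup>+x. F x * c \<partial>PiM ?J (\<lambda>_. unit_uniform))"
  proof (rule nn_integral_cong_AE)
    have "AE x in PiM ?J (\<lambda>_. unit_uniform). x v \<in> {0..<1}"
      using I by (intro AE_PiM_component prob_space_unit_uniform AE_unit_uniform) auto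
    then show "AE x in PiM ?J (\<lambda>_. unit_uniform). F x * emeasure unit_uniform {a. circle_dist a (x v) > t} = F x * c"
      by eventually_elim (simp only: c_def emeasure_circle_dist_gt[OF t] atLeastLessThan_iff)
  qed
  \<comment> \<open>A trivial integration over \<open>u\<close> is put back, so that Fubini leads
    back to the product over all of \<open>I\<close>.\<close>
  also have "\<dots> = (\<integral>\<^sup>+x. (\<integral>\<^sup>+y. F (x(u := y)) * c \<partial>unit_uniform) \<partial>PiM ?J (\<lambda>_. unit_uniform))"
    using U.emeasure_space_1 by (simp add: F_indep)
  also have "\<dots> = (\<integral>\<^sup>+x. F x * c \<partial>PiM I (\<lambda>_. unit_uniform))"
    using I(1) by (intro fubini[symmetric]) simp_all
  also have "\<dots> = c * (\<integral>\<^sup>+x. F x \<partial>PiM I (\<lambda>_. unit_uniform))"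
    by (subst nn_integral_multc) (auto simp: mult.commute)
  finally show ?thesis by (simp add: c_def)
qed

section \<open>Pairwise independence of the far-apart events\<close>

definition ordered_pairs :: "'a::linorder set \<Rightarrow> ('a \<times> 'a) set" where
  "ordered_pairs S = {(u, v). u \<in> S \<and> v \<in> S \<and> u < v}"

lemma finite_ordered_pairs: "finite S \<Longrightarrow> finite (ordered_pairs S)"
  by (rule finite_subset[of _ "S \<times> S"]) (auto simp: ordered_pairs_def)

text \<open>Here \<open>x\<close> holds one coordinate of every vertex, so this is an event of a
  single dimension. The pair is one argument because it indexes the family of events in the
  Bonferroni bound.\<close>

definition far_apart :: "'a set \<Rightarrow> real \<Rightarrow> 'a \<times> 'a \<Rightarrow> ('a \<Rightarrow> real) set" where
  "far_apart I t e = {x \<in> space (PiM I (\<lambda>_. unit_uniform)). circle_dist (x (fst e)) (x (snd e)) > t}"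

lemma far_apart_swap: "far_apart I t (u, v) = far_apart I t (v, u)"
  by (simp add: far_apart_def circle_dist_commute)

lemma sets_far_apart [measurable]:
  assumes "fst e \<in> I" "snd e \<in> I"
  shows "far_apart I t e \<in> sets (PiM I (\<lambda>_. unit_uniform))"
proof -
  note [measurable] = assms[THEN borel_measurable_PiM_unit_uniform]
  show ?thesis unfolding far_apart_def by measurable
qed

lemma measure_far_apart_Int:
  assumes I: "finite I" "u \<in> I" "v \<in> I" "u \<noteq> v" and t: "t \<ge> 0"
    and B: "B \<in> sets (PiM I (\<lambda>_. unit_uniform))"
    and B_indep: "\<And>x a. x \<in> space (PiM I (\<lambda>_. unit_uniform)) \<Longrightarrow> x(u := a) \<in> B \<longleftrightarrow> x \<in> B"
  shows "measure (PiM I (\<lambda>_. unit_uniform)) (far_apart I t (u, v) \<inter> B)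
    = max 0 (1 - 2 * t) * measure (PiM I (\<lambda>_. unit_uniform)) B"
proof -
  let ?P = "PiM I (\<lambda>_. unit_uniform)"
  interpret P: prob_space ?P by (intro prob_space_PiM prob_space_unit_uniform)
  \<comment> \<open>Restricting to \<open>I\<close> makes \<open>F\<close> insensitive to
    \<open>u\<close> on all functions, also on those outside the product space, as the integral
    identity demands.\<close>
  define F :: "('a \<Rightarrow> real) \<Rightarrow> ennreal" where "F x = indicator B (restrict x I)" for x
  have restr: "restrict x I = x" if "x \<in> space ?P" for x
    using that by (auto simp: space_PiM PiE_def extensional_restrict)
  have F_eq: "F x = indicator B x" if "x \<in> space ?P" for x
    using restr[OF that] by (simp add: F_def)
  have "F \<in> borel_measurable ?P"
    using B by (subst measurable_cong[OF F_eq]) auto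
  moreover have "F (x(u := a)) = F x" for x a
  proof -
    have "restrict x I \<in> space ?P" by (simp add: space_PiM)
    moreover have "restrict (x(u := a)) I = (restrict x I)(u := a)" using I by auto
    ultimately show ?thesis using B_indep by (simp add: F_def indicator_def)
  qed
  ultimately have "(\<integral>\<^sup>+x. F x * indicator {x. circle_dist (x u) (x v) > t} x \<partial>?P)
      = ennreal (max 0 (1 - 2 * t)) * (\<integral>\<^sup>+x. F x \<partial>?P)"
    by (rule nn_integral_PiM_circle_dist_gt[OF I t])
  also have "(\<integral>\<^sup>+x. F x \<partial>?P) = emeasure ?P B"
    using B by (subst nn_integral_cong[OF F_eq]) auto
  also have "(\<integral>\<^sup>+x. F x * indicator {x. circle_dist (x u) (x v) > t} x \<partial>?P)
      = (\<integral>\<^sup>+x. indicator (far_apart I t (u, v) \<inter> B) x \<partial>?P)"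
    by (intro nn_integral_cong) (auto simp: F_eq far_apart_def indicator_def)
  also have "\<dots> = emeasure ?P (far_apart I t (u, v) \<inter> B)"
    using I B by (intro nn_integral_indicator sets.Int sets_far_apart) auto
  finally show ?thesis
    by (simp add: P.emeasure_eq_measure ennreal_mult'[symmetric] max_def split: if_splits)
qed

lemma measure_far_apart:
  assumes I: "finite I" "u \<in> I" "v \<in> I" "u \<noteq> v" and t: "t \<ge> 0"
  shows "measure (PiM I (\<lambda>_. unit_uniform)) (far_apart I t (u, v)) = max 0 (1 - 2 * t)"
proof -
  let ?P = "PiM I (\<lambda>_. unit_uniform)"
  interpret P: prob_space ?P by (intro prob_space_PiM prob_space_unit_uniform)
  have "far_apart I t (u, v) \<inter> space ?P = far_apart I t (u, v)"
    by (auto simp: far_apart_def)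
  moreover have "x(u := a) \<in> space ?P \<longleftrightarrow> x \<in> space ?P" if "x \<in> space ?P" for x a
    using that I by (auto simp: space_PiM PiE_def extensional_def)
  ultimately show ?thesis
    using measure_far_apart_Int[OF I t, of "space ?P"] by (simp add: P.prob_space)
qed

text \<open>Two distinct pairs share at most one vertex, so \<open>e\<close> has an endpoint outside
  \<open>f\<close>. Moving that endpoint does not affect the event of \<open>f\<close>, while the
  probability of the event of \<open>e\<close>, given all other coordinates, is almost surely
  constant.\<close>

lemma measure_far_apart_indep:
  fixes e f :: "'a::linorder \<times> 'a"
  assumes I: "finite I" "S \<subseteq> I" and ef: "e \<in> ordered_pairs S" "f \<in> ordered_pairs S" "e \<noteq> f"
    and t: "t \<ge> 0" "t' \<ge> 0"
  shows "measure (PiM I (\<lambda>_. unit_uniform)) (far_apart I t e \<inter> far_apart I t' f)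
    = measure (PiM I (\<lambda>_. unit_uniform)) (far_apart I t e) * measure (PiM I (\<lambda>_. unit_uniform)) (far_apart I t' f)"
proof -
  let ?P = "PiM I (\<lambda>_. unit_uniform)"
  have main: "measure ?P (far_apart I t (u, v) \<inter> far_apart I t' f)
      = measure ?P (far_apart I t (u, v)) * measure ?P (far_apart I t' f)"
    if "u \<in> I" "v \<in> I" "u \<noteq> v" "u \<noteq> fst f" "u \<noteq> snd f" for u v
  proof -
    have "x(u := a) \<in> far_apart I t' f \<longleftrightarrow> x \<in> far_apart I t' f" if "x \<in> space ?P" for x a
      using that \<open>u \<in> I\<close> \<open>u \<noteq> fst f\<close> \<open>u \<noteq> snd f\<close>
      by (auto simp: far_apart_def space_PiM PiE_def extensional_def)
    moreover have "far_apart I t' f \<in> sets ?P"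
      using ef I by (intro sets_far_apart) (auto simp: ordered_pairs_def)
    ultimately show ?thesis
      using measure_far_apart_Int[OF I(1) that(1-3) t(1)] measure_far_apart[OF I(1) that(1-3) t(1)]
      by simp
  qed
  obtain u v where e: "e = (u, v)" by (cases e)
  then have uv: "u \<in> I" "v \<in> I" "u \<noteq> v" using ef I by (auto simp: ordered_pairs_def)
  show ?thesis
  proof (cases "u \<noteq> fst f \<and> u \<noteq> snd f")
    case True
    then show ?thesis using main[OF uv] e by simp
  next
    case False
    \<comment> \<open>Both pairs are increasing, so they would coincide if \<open>f\<close>
      contained both endpoints of \<open>e\<close>.\<close>
    then have "v \<noteq> fst f \<and> v \<noteq> snd f" using ef e by (auto simp: ordered_pairs_def)
    then show ?thesis using main[of v u] uv e far_apart_swap[of I t u v] by simp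
  qed
qed

section \<open>From the Bonferroni bound to a product of powers\<close>

lemma exp_minus_le_quadratic:
  fixes x :: real
  assumes "x \<ge> 0"
  shows "exp (- x) \<le> 1 - x + x\<^sup>2 / 2"
proof -
  have pos: "1 + x + x\<^sup>2 / 2 > 0" using assms by (intro add_pos_nonneg) auto
  have "exp (- x) = 1 / exp x" by (simp add: exp_minus field_simps)
  also have "\<dots> \<le> 1 / (1 + x + x\<^sup>2 / 2)"
    using exp_lower_Taylor_quadratic[OF assms] pos by (intro divide_left_mono) auto
  also have "\<dots> \<le> 1 - x + x\<^sup>2 / 2"
  proof -
    \<comment> \<open>The product equals (1 + x^2 / 2)^2 - x^2, which is at least 1.\<close>
    have "(1 - x + x\<^sup>2 / 2) * (1 + x + x\<^sup>2 / 2) = 1 + x ^ 4 / 4"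
      by (simp add: field_simps power2_eq_square power4_eq_xxxx)
    moreover have "x ^ 4 \<ge> 0" by simp
    ultimately show ?thesis using pos by (simp add: divide_le_eq)
  qed
  finally show ?thesis .
qed

text \<open>With D the sum of the \<open>\<delta> e\<close>, the number \<open>m\<close> lies
  between D - D^2 / 2 and D, so the left side is at most 1 - D + D^2. As D is at most 1 - s, this is
  at most 1 - s D. Weakening the exponent from D to s D absorbs the quadratic error.\<close>

lemma quadratic_bound_le_exp:
  fixes \<delta> :: "'a \<Rightarrow> real"
  assumes "finite E" and \<delta>: "\<And>e. e \<in> E \<Longrightarrow> \<delta> e \<ge> 0" and sum: "(\<Sum>e\<in>E. \<delta> e) \<le> 1 - s"
  defines "m \<equiv> (\<Sum>e\<in>E. 1 - exp (- \<delta> e))"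
  shows "1 - m + m\<^sup>2 / 2 \<le> exp (- s * (\<Sum>e\<in>E. \<delta> e))"
proof -
  define D where "D = (\<Sum>e\<in>E. \<delta> e)"
  have D0: "D \<ge> 0" unfolding D_def by (intro sum_nonneg \<delta>)
  have "1 - exp (- x) \<le> x" for x :: real using exp_ge_add_one_self[of "- x"] by simp
  then have "m \<le> D" unfolding m_def D_def by (intro sum_mono)
  moreover have "m \<ge> 0" unfolding m_def using \<delta> by (intro sum_nonneg) simp
  ultimately have m2: "m\<^sup>2 \<le> D\<^sup>2" by (intro power_mono)
  have sq: "(\<Sum>e\<in>E. (\<delta> e)\<^sup>2) \<le> D\<^sup>2"
  proof -
    have "(\<Sum>e\<in>E. (\<delta> e)\<^sup>2) \<le> (\<Sum>e\<in>E. \<delta> e * D)"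
      unfolding power2_eq_square D_def using assms(1) \<delta>
      by (intro sum_mono mult_left_mono member_le_sum) auto
    then show ?thesis by (simp add: sum_distrib_right[symmetric] D_def power2_eq_square)
  qed
  have "m \<ge> (\<Sum>e\<in>E. \<delta> e - (\<delta> e)\<^sup>2 / 2)"
    unfolding m_def by (intro sum_mono) (use exp_minus_le_quadratic \<delta> in force)
  also have "(\<Sum>e\<in>E. \<delta> e - (\<delta> e)\<^sup>2 / 2) = D - (\<Sum>e\<in>E. (\<delta> e)\<^sup>2) / 2"
    by (simp add: sum_subtractf D_def sum_divide_distrib)
  finally have "m \<ge> D - D\<^sup>2 / 2" using sq by simp
  then have "1 - m + m\<^sup>2 / 2 \<le> 1 - D + D * D" using m2 by (simp add: power2_eq_square)
  also have "\<dots> \<le> 1 - D + D * (1 - s)"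
    using sum D0 by (intro add_left_mono mult_left_mono) (auto simp: D_def)
  also have "\<dots> = 1 + (- s * D)" by (simp add: algebra_simps)
  also have "\<dots> \<le> exp (- s * D)" by (rule exp_ge_add_one_self)
  finally show ?thesis by (simp add: D_def)
qed

text \<open>The event concerns one dimension; its \<open>d\<close>-th power is the probability of
  closeness in all of them. Each pair is far apart with probability 1 - exp (-
  \<open>\<delta> e\<close>), the Bonferroni bound turns this into an exponential of the sum, and
  the \<open>d\<close>-th power cancels the division by \<open>d\<close> inside
  \<open>\<delta>\<close>. The hypothesis \<open>small\<close> says that the
  \<open>\<delta> e\<close> add up to at most 1 - s.\<close>

lemma measure_all_close_power_le:
  fixes \<kappa> :: "'a::linorder \<times> 'a \<Rightarrow> real"
  assumes I: "finite I" "S \<subseteq> I" and d: "d > 0" and s: "s \<ge> 0"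
    and \<kappa>: "\<And>e. e \<in> ordered_pairs S \<Longrightarrow> \<kappa> e > 0"
    and small: "(\<Sum>e\<in>ordered_pairs S. - ln (min 1 (\<kappa> e))) \<le> (1 - s) * real d"
  shows "measure (PiM I (\<lambda>_. unit_uniform)) {x \<in> space (PiM I (\<lambda>_. unit_uniform)).
      \<forall>e\<in>ordered_pairs S. circle_dist (x (fst e)) (x (snd e)) \<le> 1 / 2 * \<kappa> e powr (1 / real d)} ^ d
    \<le> (\<Prod>e\<in>ordered_pairs S. \<kappa> e powr s)"
proof -
  let ?P = "PiM I (\<lambda>_. unit_uniform)" and ?E = "ordered_pairs S"
  interpret P: prob_space ?P by (intro prob_space_PiM prob_space_unit_uniform)
  define t where "t e = 1 / 2 * \<kappa> e powr (1 / real d)" for e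
  define \<delta> where "\<delta> e = - ln (min 1 (\<kappa> e)) / real d" for e
  have t0: "t e \<ge> 0" for e by (simp add: t_def)
  have fin: "finite ?E" using I finite_subset by (blast intro: finite_ordered_pairs)
  have \<delta>0: "\<delta> e \<ge> 0" if "e \<in> ?E" for e
    unfolding \<delta>_def using \<kappa>[OF that] by (intro divide_nonneg_nonneg) auto
  have prob: "P.prob (far_apart I (t e) e) = 1 - exp (- \<delta> e)" if "e \<in> ?E" for e
  proof -
    obtain u v where e: "e = (u, v)" by (cases e)
    have "P.prob (far_apart I (t e) (u, v)) = max 0 (1 - 2 * t e)"
      using that e I by (intro measure_far_apart t0) (auto simp: ordered_pairs_def)
    also have "\<dots> = 1 - exp (- \<delta> e)"
    proof (cases "\<kappa> e \<le> 1")
      case True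
      then have "2 * t e = exp (- \<delta> e)" using \<kappa>[OF that] by (simp add: t_def \<delta>_def powr_def min_def)
      moreover have "exp (- \<delta> e) \<le> 1" using \<delta>0[OF that] by simp
      ultimately show ?thesis by simp
    next
      \<comment> \<open>The radius is now at least 1/2, which no circle distance exceeds, and the
        truncation makes \<open>\<delta> e\<close> equal to 0.\<close>
      case False
      then show ?thesis by (simp add: t_def \<delta>_def ge_one_powr_ge_zero)
    qed
    finally show ?thesis by (simp add: e)
  qed
  have eq: "{x \<in> space ?P. \<forall>e\<in>?E. circle_dist (x (fst e)) (x (snd e)) \<le> t e}
      = space ?P - (\<Union>e\<in>?E. far_apart I (t e) e)"
    by (auto simp: far_apart_def not_less)
  define m where "m = (\<Sum>e\<in>?E. 1 - exp (- \<delta> e))"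
  have "P.prob (space ?P - (\<Union>e\<in>?E. far_apart I (t e) e)) \<le> 1 - m + m\<^sup>2 / 2"
  proof -
    have "m = (\<Sum>e\<in>?E. P.prob (far_apart I (t e) e))"
      unfolding m_def by (intro sum.cong refl) (simp add: prob)
    moreover have "far_apart I (t e) e \<in> P.events" if "e \<in> ?E" for e
      using that I by (intro sets_far_apart) (auto simp: ordered_pairs_def)
    ultimately show ?thesis
      using P.prob_no_event_le[OF fin, of "\<lambda>e. far_apart I (t e) e"]
        measure_far_apart_indep[OF I _ _ _ t0 t0] by simp
  qed
  also have "\<dots> \<le> exp (- s * (\<Sum>e\<in>?E. \<delta> e))"
    unfolding m_def
  proof (rule quadratic_bound_le_exp[OF fin \<delta>0])
    show "(\<Sum>e\<in>?E. \<delta> e) \<le> 1 - s"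
      using small d unfolding \<delta>_def sum_divide_distrib[symmetric] by (simp add: pos_divide_le_eq)
  qed
  finally have "P.prob (space ?P - (\<Union>e\<in>?E. far_apart I (t e) e)) ^ d \<le> exp (- s * (\<Sum>e\<in>?E. \<delta> e)) ^ d"
    by (intro power_mono) auto
  also have "\<dots> = exp (\<Sum>e\<in>?E. s * ln (min 1 (\<kappa> e)))"
    using d by (simp add: exp_of_nat_mult[symmetric] \<delta>_def sum_divide_distrib[symmetric] sum_negf sum_distrib_left[symmetric])
  also have "\<dots> = (\<Prod>e\<in>?E. exp (s * ln (min 1 (\<kappa> e))))"
    using fin by (rule exp_sum)
  also have "\<dots> \<le> (\<Prod>e\<in>?E. \<kappa> e powr s)"
  proof (intro prod_mono conjI)
    fix e assume e: "e \<in> ?E"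
    \<comment> \<open>Dropping the truncation only increases the bound, as \<open>s\<close> is
      nonnegative, and leaves pure powers in which the weights can be separated.\<close>
    have "ln (min 1 (\<kappa> e)) \<le> ln (\<kappa> e)" using \<kappa>[OF e] by (auto simp: min_def)
    then show "exp (s * ln (min 1 (\<kappa> e))) \<le> \<kappa> e powr s"
      using \<kappa>[OF e] s by (simp add: powr_def mult_left_mono)
  qed simp
  finally show ?thesis unfolding eq[unfolded t_def] by (simp add: t_def)
qed

subsection \<open>Rearranging product measures\<close>

text \<open>This separates weights from positions, so that one can condition on all weights at once.
  A finite product measure is determined by its values on boxes, where Fubini and independence over
  the vertices reduce the claim to a single vertex.\<close>

lemma distr_PiM_zip:
  assumes I: "finite I" and M: "prob_space M" and N: "prob_space N"
  shows "distr (PiM I (\<lambda>_. M) \<Otimes>\<^sub>M PiM I (\<lambda>_. N)) (PiM I (\<lambda>_. M \<Otimes>\<^sub>M N))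
           (\<lambda>(w, x). \<lambda>v\<in>I. (w v, x v)) = PiM I (\<lambda>_. M \<Otimes>\<^sub>M N)"
proof -
  interpret M: prob_space M by fact
  interpret N: prob_space N by fact
  interpret MN: pair_prob_space M N ..
  interpret PM: product_prob_space "\<lambda>_. M" I by unfold_locales
  interpret PN: product_prob_space "\<lambda>_. N" I by unfold_locales
  interpret PMN: product_prob_space "\<lambda>_. M \<Otimes>\<^sub>M N" I by unfold_locales
  let ?PM = "PiM I (\<lambda>_. M)" and ?PN = "PiM I (\<lambda>_. N)"
  have meas: "(\<lambda>(w, x). \<lambda>v\<in>I. (w v, x v)) \<in> ?PM \<Otimes>\<^sub>M ?PN \<rightarrow>\<^sub>M PiM I (\<lambda>_. M \<Otimes>\<^sub>M N)"
    by measurable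
  show ?thesis
  proof (rule PMN.PiM_eqI[OF I])
    fix A assume A [measurable]: "\<And>i. i \<in> I \<Longrightarrow> A i \<in> sets (M \<Otimes>\<^sub>M N)"
    have box: "Pi\<^sub>E I A \<in> sets (PiM I (\<lambda>_. M \<Otimes>\<^sub>M N))" using I A by (rule sets_PiM_I_finite)
    have "emeasure (distr (?PM \<Otimes>\<^sub>M ?PN) (PiM I (\<lambda>_. M \<Otimes>\<^sub>M N)) (\<lambda>(w, x). \<lambda>v\<in>I. (w v, x v))) (Pi\<^sub>E I A)
        = (\<integral>\<^sup>+z. indicator (Pi\<^sub>E I A) (case z of (w, x) \<Rightarrow> \<lambda>v\<in>I. (w v, x v)) \<partial>(?PM \<Otimes>\<^sub>M ?PN))"
      using nn_integral_distr[OF meas, of "indicator (Pi\<^sub>E I A)"] box by simp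
    also have "\<dots> = (\<integral>\<^sup>+w. \<integral>\<^sup>+x. indicator (Pi\<^sub>E I A) (\<lambda>v\<in>I. (w v, x v)) \<partial>?PN \<partial>?PM)"
      using measurable_compose[OF meas borel_measurable_indicator[OF box]]
      by (subst PN.nn_integral_fst[symmetric]) auto
    also have "\<dots> = (\<integral>\<^sup>+w. \<integral>\<^sup>+x. (\<Prod>v\<in>I. indicator (A v) (w v, x v)) \<partial>?PN \<partial>?PM)"
      using I by (intro nn_integral_cong) (auto simp: indicator_def prod_eq_1_iff PiE_iff intro!: prod_zero)
    also have "\<dots> = (\<integral>\<^sup>+w. (\<Prod>v\<in>I. \<integral>\<^sup>+x. indicator (A v) (w v, x) \<partial>N) \<partial>?PM)"
      by (intro nn_integral_cong PN.product_nn_integral_prod I)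
         (auto simp: space_PiM PiE_iff intro!: measurable_compose[OF measurable_Pair1' borel_measurable_indicator])
    also have "\<dots> = (\<Prod>v\<in>I. \<integral>\<^sup>+w. \<integral>\<^sup>+x. indicator (A v) (w, x) \<partial>N \<partial>M)"
      using A by (intro PM.product_nn_integral_prod I) measurable
    also have "\<dots> = (\<Prod>v\<in>I. emeasure (M \<Otimes>\<^sub>M N) (A v))"
      using A by (intro prod.cong refl) (simp add: N.nn_integral_fst)
    finally show "emeasure (distr (?PM \<Otimes>\<^sub>M ?PN) (PiM I (\<lambda>_. M \<Otimes>\<^sub>M N)) (\<lambda>(w, x). \<lambda>v\<in>I. (w v, x v))) (Pi\<^sub>E I A)
      = (\<Prod>v\<in>I. emeasure (M \<Otimes>\<^sub>M N) (A v))" .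
  qed simp
qed

text \<open>Independent vertices with independent coordinates yield independent dimensions: all
  entries \<open>x v j\<close> are jointly independent, and the columns are functions of disjoint
  blocks of entries.\<close>

lemma measure_PiM_PiM_columns:
  assumes I: "finite I" "I \<noteq> {}" and J: "finite J" "J \<noteq> {}" and U: "prob_space U"
    and B: "\<And>j. j \<in> J \<Longrightarrow> B j \<in> sets (PiM I (\<lambda>_. U))"
  shows "measure (PiM I (\<lambda>_. PiM J (\<lambda>_. U)))
      {x \<in> space (PiM I (\<lambda>_. PiM J (\<lambda>_. U))). \<forall>j\<in>J. (\<lambda>v\<in>I. x v j) \<in> B j}
    = (\<Prod>j\<in>J. measure (PiM I (\<lambda>_. U)) (B j))"
proof -
  let ?N = "PiM I (\<lambda>_. PiM J (\<lambda>_. U))" and ?X = "\<lambda>p x. x (fst p) (snd p)"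
  interpret U: prob_space U by fact
  have T: "prob_space (PiM J (\<lambda>_. U))" by (intro prob_space_PiM U)
  interpret N: prob_space ?N by (intro prob_space_PiM T)
  interpret PJ: product_prob_space "\<lambda>_. U" J by unfold_locales
  interpret TJ: prob_space "PiM J (\<lambda>_. U)" by (rule T)
  interpret PI: product_prob_space "\<lambda>_. U" I by unfold_locales
  interpret PIJ: product_prob_space "\<lambda>_. U" "I \<times> J" by unfold_locales
  interpret NN: product_prob_space "\<lambda>_. PiM J (\<lambda>_. U)" I by unfold_locales
  have X_meas: "?X p \<in> ?N \<rightarrow>\<^sub>M U" if "p \<in> I \<times> J" for p
  proof -
    have "(\<lambda>x. x (fst p)) \<in> ?N \<rightarrow>\<^sub>M PiM J (\<lambda>_. U)" "(\<lambda>y. y (snd p)) \<in> PiM J (\<lambda>_. U) \<rightarrow>\<^sub>M U"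
      using that by (auto intro!: measurable_component_singleton)
    from measurable_compose[OF this] show ?thesis .
  qed
  have col_meas: "(\<lambda>x. \<lambda>v\<in>I. x v j) \<in> ?N \<rightarrow>\<^sub>M PiM I (\<lambda>_. U)" if "j \<in> J" for j
    using X_meas that by (intro measurable_restrict) auto
  \<comment> \<open>Flattening to the index set \<open>I \<times> J\<close> is checked on boxes,
    whose preimages are boxes of boxes.\<close>
  have flat: "distr ?N (PiM (I \<times> J) (\<lambda>_. U)) (\<lambda>x. \<lambda>p\<in>I\<times>J. ?X p x) = PiM (I \<times> J) (\<lambda>_. U)"
  proof (rule PIJ.PiM_eqI)
    fix A assume A: "\<And>p. p \<in> I \<times> J \<Longrightarrow> A p \<in> sets U"
    have "(\<lambda>x. \<lambda>p\<in>I\<times>J. ?X p x) -` Pi\<^sub>E (I \<times> J) A \<inter> space ?N = (\<Pi>\<^sub>E v\<in>I. \<Pi>\<^sub>E j\<in>J. A (v, j))"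
      using A[THEN sets.sets_into_space] by (auto simp: space_PiM PiE_iff subset_eq)
    then have "emeasure (distr ?N (PiM (I \<times> J) (\<lambda>_. U)) (\<lambda>x. \<lambda>p\<in>I\<times>J. ?X p x)) (Pi\<^sub>E (I \<times> J) A)
        = emeasure ?N (\<Pi>\<^sub>E v\<in>I. \<Pi>\<^sub>E j\<in>J. A (v, j))"
      using A I J X_meas by (subst emeasure_distr) (auto intro!: sets_PiM_I_finite measurable_restrict)
    also have "\<dots> = (\<Prod>v\<in>I. \<Prod>j\<in>J. emeasure U (A (v, j)))"
      using A I J by (simp add: NN.emeasure_PiM PJ.emeasure_PiM sets_PiM_I_finite)
    also have "\<dots> = (\<Prod>p\<in>I\<times>J. emeasure U (A p))"
      by (simp add: prod.cartesian_product)
    finally show "emeasure (distr ?N (PiM (I \<times> J) (\<lambda>_. U)) (\<lambda>x. \<lambda>p\<in>I\<times>J. ?X p x)) (Pi\<^sub>E (I \<times> J) A)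
        = (\<Prod>p\<in>I\<times>J. emeasure U (A p))" .
  qed (use I J in auto)
  have comp: "distr ?N U (?X p) = U" if p: "p \<in> I \<times> J" for p
  proof -
    have "distr ?N U (?X p) = distr (distr ?N (PiM J (\<lambda>_. U)) (\<lambda>x. x (fst p))) U (\<lambda>y. y (snd p))"
      using p by (subst distr_distr) (auto simp: comp_def intro!: measurable_component_singleton)
    also have "\<dots> = U"
      using p by (simp add: distr_PiM_component[of I "\<lambda>_. PiM J (\<lambda>_. U)"] T
          distr_PiM_component[of J "\<lambda>_. U"] U mem_Times_iff)
    finally show ?thesis .
  qed
  have indep: "N.indep_vars (\<lambda>_. U) ?X (I \<times> J)"
  proof (subst N.indep_vars_iff_distr_eq_PiM')
    show "distr ?N (PiM (I \<times> J) (\<lambda>_. U)) (\<lambda>x. \<lambda>p\<in>I\<times>J. ?X p x) = PiM (I \<times> J) (\<lambda>p. distr ?N U (?X p))"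
      unfolding flat by (intro PiM_cong refl) (simp only: comp)
  qed (use I J X_meas in auto)
  have "N.indep_vars (\<lambda>j. PiM (I \<times> {j}) (\<lambda>_. U)) (\<lambda>j x. \<lambda>p\<in>I\<times>{j}. ?X p x) J"
    by (rule N.indep_vars_restrict[OF indep]) (auto simp: disjoint_family_on_def)
  then have "N.indep_vars (\<lambda>_. PiM I (\<lambda>_. U)) (\<lambda>j x. (\<lambda>z. \<lambda>v\<in>I. z (v, j)) (\<lambda>p\<in>I\<times>{j}. ?X p x)) J"
  proof (rule N.indep_vars_compose2)
    show "(\<lambda>z. \<lambda>v\<in>I. z (v, j)) \<in> PiM (I \<times> {j}) (\<lambda>_. U) \<rightarrow>\<^sub>M PiM I (\<lambda>_. U)" for j
      by (rule measurable_restrict) (rule measurable_component_singleton, simp)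
  qed
  also have "?this \<longleftrightarrow> N.indep_vars (\<lambda>_. PiM I (\<lambda>_. U)) (\<lambda>j x. \<lambda>v\<in>I. x v j) J"
    by (intro N.indep_vars_cong) (auto simp: fun_eq_iff)
  finally have "N.prob (\<Inter>j\<in>J. (\<lambda>x. \<lambda>v\<in>I. x v j) -` B j \<inter> space ?N)
      = (\<Prod>j\<in>J. N.prob ((\<lambda>x. \<lambda>v\<in>I. x v j) -` B j \<inter> space ?N))"
    using J B by (intro N.indep_varsD_finite) auto
  also have "(\<Inter>j\<in>J. (\<lambda>x. \<lambda>v\<in>I. x v j) -` B j \<inter> space ?N)
      = {x \<in> space ?N. \<forall>j\<in>J. (\<lambda>v\<in>I. x v j) \<in> B j}"
    using J by auto
  also have "(\<Prod>j\<in>J. N.prob ((\<lambda>x. \<lambda>v\<in>I. x v j) -` B j \<inter> space ?N)) = (\<Prod>j\<in>J. measure (PiM I (\<lambda>_. U)) (B j))"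
  proof (rule prod.cong[OF refl])
    fix j assume j: "j \<in> J"
    \<comment> \<open>A column arises by projecting to coordinate \<open>j\<close> at each vertex
      separately, so its law is the product of the projected laws.\<close>
    have "distr ?N (PiM I (\<lambda>_. U)) (\<lambda>x. \<lambda>v\<in>I. x v j) = PiM I (\<lambda>_. U)"
      using distr_PiM_finite_prob_space'[OF I(1), of "\<lambda>_. PiM J (\<lambda>_. U)" "\<lambda>_. U" "\<lambda>y. y j"] j
      by (simp add: T U compose_def[abs_def] distr_PiM_component[of J "\<lambda>_. U"] measurable_component_singleton)
    then show "N.prob ((\<lambda>x. \<lambda>v\<in>I. x v j) -` B j \<inter> space ?N) = measure (PiM I (\<lambda>_. U)) (B j)"
      using measure_distr[OF col_meas[OF j] B[OF j]] by simp
  qed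
  finally show ?thesis .
qed

subsection \<open>Moments of the weights\<close>

lemma emeasure_weight_measure_Ioi:
  assumes "w0 > 0" "\<beta> > 1" "a \<ge> w0"
  shows "emeasure (weight_measure \<beta> w0) {a<..} = ennreal ((a / w0) powr (1 - \<beta>))"
proof -
  interpret W: prob_space "weight_measure \<beta> w0" by (rule prob_space_weight_measure) fact+
  have "{a<..} = space (weight_measure \<beta> w0) - {..a}" by (auto simp: weight_measure_def)
  then have "W.prob {a<..} = 1 - W.prob {..a}"
    by (metis W.prob_compl weight_measure_def sets_interval_measure atMost_borel)
  then show ?thesis
    using assms by (simp add: W.emeasure_eq_measure measure_weight_measure_Iic)
qed

text \<open>The distribution function is 0 at \<open>w0\<close> itself, so there is no atom there.
  The strict form lets the dyadic blocks below begin just above \<open>w0\<close>.\<close>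

lemma AE_weight_measure_gt:
  assumes "w0 > 0" "\<beta> > 1"
  shows "AE w in weight_measure \<beta> w0. w > w0"
proof -
  interpret W: prob_space "weight_measure \<beta> w0" by (rule prob_space_weight_measure) fact+
  have "{..w0} \<in> null_sets (weight_measure \<beta> w0)"
    using measure_weight_measure_Iic[OF assms, of w0] assms
    by (intro null_setsI) (simp_all add: W.emeasure_eq_measure, simp add: weight_measure_def)
  from AE_not_in[OF this] show ?thesis by eventually_elim auto
qed

text \<open>A dyadic estimate: between w0 2^j and w0 2^(j+1) the power is at most
  \<open>c j\<close>, while the tail beyond w0 2^j has mass 2^(j (1 - \<beta>)). The resulting
  series is geometric with ratio 2^(r + 1 - \<beta>), which is below 1 exactly when r < \<beta> -
  1.\<close>

lemma weight_moment_finite: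
  assumes "w0 > 0" "\<beta> > 1" "r \<ge> 0" "r < \<beta> - 1"
  shows "(\<integral>\<^sup>+w. ennreal (w powr r) \<partial>weight_measure \<beta> w0) < \<infinity>"
proof -
  let ?W = "weight_measure \<beta> w0"
  define c where "c j = (w0 * 2 ^ Suc j) powr r" for j :: nat
  have [measurable]: "{a<..} \<in> sets ?W" for a by (simp add: weight_measure_def)
  have dyadic: "ennreal (w powr r) \<le> (\<Sum>j. ennreal (c j) * indicator {w0 * 2 ^ j<..} w)" if w: "w > w0" for w
  proof -
    obtain m where "w / w0 < 2 ^ m" using real_arch_pow[of 2 "w / w0"] by auto
    then have ex: "w \<le> w0 * 2 ^ m" using assms by (simp add: field_simps)
    \<comment> \<open>As w > w0, this least exponent is positive, and its predecessor
      \<open>j\<close> names the dyadic block of w.\<close>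
    define m' where "m' = (LEAST m. w \<le> w0 * 2 ^ m)"
    have m': "w \<le> w0 * 2 ^ m'" unfolding m'_def using ex by (rule LeastI)
    with w have "m' \<noteq> 0" by (cases m') auto
    then obtain j where j: "m' = Suc j" by (cases m') auto
    have "\<not> w \<le> w0 * 2 ^ j" using not_less_Least[of j "\<lambda>m. w \<le> w0 * 2 ^ m"] j m'_def by simp
    then have "ennreal (w powr r) \<le> ennreal (c j) * indicator {w0 * 2 ^ j<..} w"
      using m' j assms w by (auto simp: c_def intro!: ennreal_leI powr_mono2)
    \<comment> \<open>The half-lines overlap, so the series overcounts; the term of the block of w
      alone suffices.\<close>
    also have "\<dots> \<le> (\<Sum>j. ennreal (c j) * indicator {w0 * 2 ^ j<..} w)"
      using sum_le_suminf[OF summableI, of "{j}" "\<lambda>j. ennreal (c j) * indicator {w0 * 2 ^ j<..} w"]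
      by (simp del: sum_mult_indicator)
    finally show ?thesis .
  qed
  have "(\<integral>\<^sup>+w. ennreal (w powr r) \<partial>?W) \<le> (\<integral>\<^sup>+w. (\<Sum>j. ennreal (c j) * indicator {w0 * 2 ^ j<..} w) \<partial>?W)"
    using AE_weight_measure_gt[OF assms(1,2)] by (intro nn_integral_mono_AE) (auto elim: eventually_mono dyadic)
  also have "\<dots> = (\<Sum>j. ennreal (c j) * emeasure ?W {w0 * 2 ^ j<..})"
    by (subst nn_integral_suminf) (auto simp: nn_integral_cmult_indicator)
  also have "\<dots> = (\<Sum>j. ennreal ((w0 * 2) powr r * (2 powr (r + 1 - \<beta>)) ^ j))"
  proof (intro suminf_cong)
    fix j :: nat
    have "emeasure ?W {w0 * 2 ^ j<..} = ennreal ((2 ^ j) powr (1 - \<beta>))"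
      using assms by (subst emeasure_weight_measure_Ioi) auto
    moreover have "c j * (2 ^ j) powr (1 - \<beta>) = (w0 * 2) powr r * (2 powr (r + 1 - \<beta>)) ^ j"
    proof -
      have pow: "(2 ^ j) powr a = (2 powr a) ^ j" for a :: real
      proof -
        have "(2 ^ j) powr a = (2 powr real j) powr a" by (simp add: powr_realpow)
        also have "\<dots> = (2 powr a) powr real j" by (simp only: powr_powr mult.commute)
        also have "\<dots> = (2 powr a) ^ j" by (simp add: powr_realpow)
        finally show ?thesis .
      qed
      have "w0 * 2 ^ Suc j = (w0 * 2) * 2 ^ j" by simp
      then have "c j = (w0 * 2) powr r * (2 powr r) ^ j"
        using assms unfolding c_def by (simp only: powr_mult pow)
      moreover have "(2::real) powr r * 2 powr (1 - \<beta>) = 2 powr (r + 1 - \<beta>)"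
        by (simp only: powr_add[symmetric] add_diff_eq)
      ultimately show ?thesis
        by (simp only: pow mult.assoc power_mult_distrib[symmetric])
    qed
    ultimately show "ennreal (c j) * emeasure ?W {w0 * 2 ^ j<..}
        = ennreal ((w0 * 2) powr r * (2 powr (r + 1 - \<beta>)) ^ j)"
      by (simp add: c_def ennreal_mult'[symmetric])
  qed
  also have "\<dots> < \<infinity>"
  proof -
    have "2 powr (r + 1 - \<beta>) < 2 powr (0::real)" using assms by (intro powr_less_mono) auto
    then have "summable (\<lambda>j. (w0 * 2) powr r * (2 powr (r + 1 - \<beta>)) ^ j)"
      by (intro summable_mult summable_geometric) auto
    then have "(\<Sum>j. ennreal ((w0 * 2) powr r * (2 powr (r + 1 - \<beta>)) ^ j)) \<noteq> top"
      by (rule ennreal_suminf_neq_top) simp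
    then show ?thesis unfolding infinity_ennreal_def less_top[symmetric] .
  qed
  finally show ?thesis .
qed

subsection \<open>Expected number of cliques\<close>

lemma sum_ordered_pairs:
  fixes f :: "'a::linorder \<Rightarrow> real"
  assumes "finite S"
  shows "(\<Sum>e\<in>ordered_pairs S. f (fst e) + f (snd e)) = (real (card S) - 1) * (\<Sum>v\<in>S. f v)"
proof -
  let ?P = "ordered_pairs S"
  have fin: "finite ?P" using assms by (rule finite_ordered_pairs)
  \<comment> \<open>Increasing pairs, their mirror images and the diagonal partition the square; the
    diagonal accounts for the -1 in the factor.\<close>
  have split: "S \<times> S = (?P \<union> prod.swap ` ?P) \<union> (\<lambda>v. (v, v)) ` S"
    by (auto simp: ordered_pairs_def image_iff)
  have "real (card S) * (\<Sum>v\<in>S. f v) = (\<Sum>e\<in>S\<times>S. f (fst e))"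
    using sum.cartesian_product[of "\<lambda>u _. f u" S S] by (simp add: case_prod_unfold sum_distrib_left)
  also have "\<dots> = (\<Sum>e\<in>?P. f (fst e)) + (\<Sum>e\<in>prod.swap ` ?P. f (fst e)) + (\<Sum>e\<in>(\<lambda>v. (v, v)) ` S. f (fst e))"
    unfolding split using fin assms
    by (subst sum.union_disjoint; (subst sum.union_disjoint)?) (auto simp: ordered_pairs_def)
  also have "(\<Sum>e\<in>prod.swap ` ?P. f (fst e)) = (\<Sum>e\<in>?P. f (snd e))"
    by (subst sum.reindex) auto
  also have "(\<Sum>e\<in>(\<lambda>v. (v, v)) ` S. f (fst e)) = (\<Sum>v\<in>S. f v)"
    by (subst sum.reindex) (auto simp: inj_on_def)
  finally show ?thesis by (simp add: sum.distrib algebra_simps)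
qed

lemma card_ordered_pairs:
  assumes "finite S"
  shows "real (card (ordered_pairs S)) = real (card S) * (real (card S) - 1) / 2"
  using sum_ordered_pairs[OF assms, of "\<lambda>_. 1"] by (simp add: mult.commute)

text \<open>Every vertex lies in \<open>card S - 1\<close> pairs, so after taking logarithms the sum
  over pairs becomes a sum over vertices. This decouples the vertices and makes the expectation over
  independent weights a product of moments.\<close>

lemma prod_ordered_pairs_powr:
  fixes w :: "'a::linorder \<Rightarrow> real"
  assumes S: "finite S" and c: "c > 0" and w: "\<And>v. v \<in> S \<Longrightarrow> w v > 0"
  shows "(\<Prod>e\<in>ordered_pairs S. (c * w (fst e) * w (snd e)) powr s)
    = c powr (s * real (card (ordered_pairs S))) * (\<Prod>v\<in>S. w v powr (s * (real (card S) - 1)))"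
proof -
  let ?P = "ordered_pairs S"
  have "(\<Prod>e\<in>?P. (c * w (fst e) * w (snd e)) powr s)
      = (\<Prod>e\<in>?P. exp (s * ln c + s * (ln (w (fst e)) + ln (w (snd e)))))"
  proof (rule prod.cong[OF refl])
    fix e assume "e \<in> ?P"
    then have "w (fst e) > 0" "w (snd e) > 0" using w by (auto simp: ordered_pairs_def)
    then show "(c * w (fst e) * w (snd e)) powr s = exp (s * ln c + s * (ln (w (fst e)) + ln (w (snd e))))"
      using c by (simp add: powr_def ln_mult algebra_simps)
  qed
  also have "\<dots> = exp (\<Sum>e\<in>?P. s * ln c + s * (ln (w (fst e)) + ln (w (snd e))))"
    using finite_ordered_pairs[OF S] by (rule exp_sum[symmetric])
  also have "(\<Sum>e\<in>?P. s * ln c + s * (ln (w (fst e)) + ln (w (snd e))))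
      = s * real (card ?P) * ln c + (\<Sum>v\<in>S. s * (real (card S) - 1) * ln (w v))"
    by (simp add: sum.distrib sum_distrib_left[symmetric] sum_ordered_pairs[OF S, of "\<lambda>v. ln (w v)", unfolded sum.distrib])
  also have "exp \<dots> = c powr (s * real (card ?P)) * (\<Prod>v\<in>S. w v powr (s * (real (card S) - 1)))"
  proof -
    have "(\<Prod>v\<in>S. w v powr (s * (real (card S) - 1))) = (\<Prod>v\<in>S. exp (s * (real (card S) - 1) * ln (w v)))"
      using w by (intro prod.cong refl) (auto simp: powr_def dest: less_imp_neq[symmetric])
    also have "\<dots> = exp (\<Sum>v\<in>S. s * (real (card S) - 1) * ln (w v))"
      using S by (rule exp_sum[symmetric])
    finally show ?thesis using c by (simp add: exp_add powr_def)
  qed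
  finally show ?thesis .
qed

section \<open>Probability of a single clique\<close>

lemma torus_dist_le_iff:
  assumes "d > 0"
  shows "torus_dist d x y \<le> c \<longleftrightarrow> (\<forall>i<d. circle_dist (x i) (y i) \<le> c)"
  unfolding torus_dist_def using assms by (subst Max_le_iff) (auto simp: lessThan_empty_iff)

text \<open>The dimension is quantified outermost, which exhibits the clique event as one condition
  per dimension and prepares for the independence of the columns.\<close>

lemma clique_girg_edges_ordered_pairs:
  assumes "S \<subseteq> {..<n}" "d > 0"
  shows "clique S (girg_edges lam n d g) \<longleftrightarrow> (\<forall>i<d. \<forall>e\<in>ordered_pairs S.
    circle_dist (snd (g (fst e)) i) (snd (g (snd e)) i)
      \<le> 1 / 2 * (lam * fst (g (fst e)) * fst (g (snd e)) / real n) powr (1 / real d))"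
proof -
  have "clique S (girg_edges lam n d g) \<longleftrightarrow> (\<forall>e\<in>ordered_pairs S. girg_adj lam n d g (fst e) (snd e))"
    unfolding clique_girg_edges[OF assms(1)] ordered_pairs_def
    using girg_adj_commute[of lam n d g] by (auto simp: linorder_neq_iff)
  also have "\<dots> \<longleftrightarrow> (\<forall>e\<in>ordered_pairs S. \<forall>i<d. circle_dist (snd (g (fst e)) i) (snd (g (snd e)) i)
      \<le> 1 / 2 * (lam * fst (g (fst e)) * fst (g (snd e)) / real n) powr (1 / real d))"
    unfolding girg_adj_def torus_dist_le_iff[OF assms(2)]
    by (intro ball_cong refl) (auto simp: ordered_pairs_def)
  finally show ?thesis by blast
qed

text \<open>Condition on the weights. The clique event then asks that each of the \<open>d\<close>
  independent columns of positions lies in the same set, so its probability is a \<open>d\<close>-th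
  power, which is bounded by a product over pairs. Integrating over the independent weights leaves
  one moment per vertex in \<open>S\<close>. The hypothesis \<open>small\<close> is stated for a
  lower bound of all \<open>\<kappa> w e\<close>, so it serves almost all weights at once.\<close>

lemma emeasure_girg_clique_le:
  fixes lam w0 \<beta> s :: real
  assumes lam: "lam > 0" and w0: "w0 > 0" and \<beta>: "\<beta> > 1" and d: "d > 0" and s: "s \<ge> 0"
    and n: "n > 0" and S: "S \<subseteq> {..<n}"
    and small: "real (card (ordered_pairs S)) * (- ln (min 1 (lam * w0\<^sup>2 / real n))) \<le> (1 - s) * real d"
  shows "emeasure (girg_measure n \<beta> w0 d) {g \<in> space (girg_measure n \<beta> w0 d). clique S (girg_edges lam n d g)}
    \<le> ennreal ((lam / real n) powr (s * real (card (ordered_pairs S)))) *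
      (\<integral>\<^sup>+w. ennreal (w powr (s * (real (card S) - 1))) \<partial>weight_measure \<beta> w0) ^ card S"
proof -
  let ?I = "{..<n}" and ?W = "weight_measure \<beta> w0" and ?T = "torus_measure d"
  let ?PW = "PiM ?I (\<lambda>_. ?W)" and ?PT = "PiM ?I (\<lambda>_. ?T)" and ?G = "girg_measure n \<beta> w0 d"
  let ?U = "PiM ?I (\<lambda>_. unit_uniform)"
  let ?z = "\<lambda>(w, x). \<lambda>v\<in>?I. (w v, x v)"
  define A where "A = {g \<in> space ?G. clique S (girg_edges lam n d g)}"
  define \<kappa> where "\<kappa> w e = lam * w (fst e) * w (snd e) / real n" for w :: "nat \<Rightarrow> real" and e
  define B where "B w = {y \<in> space ?U. \<forall>e\<in>ordered_pairs S. circle_dist (y (fst e)) (y (snd e))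
      \<le> 1 / 2 * \<kappa> w e powr (1 / real d)}" for w
  define r where "r = s * (real (card S) - 1)"
  have finS: "finite S" using S finite_subset by blast
  interpret W: prob_space ?W by (rule prob_space_weight_measure) fact+
  interpret T: prob_space ?T by (rule prob_space_torus_measure)
  interpret PT: prob_space ?PT by (intro prob_space_PiM prob_space_torus_measure)
  interpret PU: prob_space ?U by (intro prob_space_PiM prob_space_unit_uniform)
  interpret PW: product_prob_space "\<lambda>_. ?W" ?I by unfold_locales
  have setsA: "A \<in> sets ?G"
    using pred_girg_clique[OF S] unfolding A_def by (simp add: pred_def)
  have G_eq: "?G = distr (?PW \<Otimes>\<^sub>M ?PT) ?G ?z"
    unfolding girg_measure_def
    by (rule distr_PiM_zip[symmetric]) (auto intro: W.prob_space_axioms T.prob_space_axioms)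
  have z_meas: "?z \<in> ?PW \<Otimes>\<^sub>M ?PT \<rightarrow>\<^sub>M ?G"
    unfolding girg_measure_def by measurable
  have setsA': "?z -` A \<inter> space (?PW \<Otimes>\<^sub>M ?PT) \<in> sets (?PW \<Otimes>\<^sub>M ?PT)"
    using z_meas setsA by (rule measurable_sets)
  have setsB: "B w \<in> sets ?U" for w
  proof -
    have "far_apart ?I (1 / 2 * \<kappa> w e powr (1 / real d)) e \<in> sets ?U" if "e \<in> ordered_pairs S" for e
      using that S by (intro sets_far_apart) (auto simp: ordered_pairs_def)
    moreover have "B w = space ?U - (\<Union>e\<in>ordered_pairs S. far_apart ?I (1 / 2 * \<kappa> w e powr (1 / real d)) e)"
      by (auto simp: B_def far_apart_def not_less)
    ultimately show ?thesis using finite_ordered_pairs[OF finS] by auto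
  qed
  have slice: "Pair w -` (?z -` A \<inter> space (?PW \<Otimes>\<^sub>M ?PT)) = {x \<in> space ?PT. \<forall>i\<in>{..<d}. (\<lambda>v\<in>?I. x v i) \<in> B w}"
    if w: "w \<in> space ?PW" for w
  proof -
    have "?z (w, x) \<in> A \<longleftrightarrow> (\<forall>i\<in>{..<d}. (\<lambda>v\<in>?I. x v i) \<in> B w)" if x: "x \<in> space ?PT" for x
    proof -
      have "?z (w, x) \<in> space ?G"
        using measurable_space[OF z_meas, of "(w, x)"] w x by (simp add: space_pair_measure)
      moreover have "(\<lambda>v\<in>?I. x v i) \<in> space ?U" for i by (simp add: space_PiM)
      moreover have "fst e < n" "snd e < n" if "e \<in> ordered_pairs S" for e
        using that S by (auto simp: ordered_pairs_def)
      ultimately show ?thesis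
        unfolding A_def B_def clique_girg_edges_ordered_pairs[OF S d] by (auto simp: \<kappa>_def)
    qed
    then show ?thesis using w by (auto simp: space_pair_measure)
  qed
  have slice_measure: "PT.prob {x \<in> space ?PT. \<forall>i\<in>{..<d}. (\<lambda>v\<in>?I. x v i) \<in> B w} = PU.prob (B w) ^ d" for w
  proof -
    have "{..<d} \<noteq> {}" "{..<n} \<noteq> {}" using d n by (auto simp: lessThan_empty_iff)
    then show ?thesis
      using measure_PiM_PiM_columns[of ?I "{..<d}" unit_uniform "\<lambda>_. B w"]
      by (simp add: setsB prob_space_unit_uniform torus_measure_def)
  qed
  have slice_le: "emeasure ?PT (Pair w -` (?z -` A \<inter> space (?PW \<Otimes>\<^sub>M ?PT)))
      \<le> ennreal ((lam / real n) powr (s * real (card (ordered_pairs S)))) * (\<Prod>v\<in>S. ennreal (w v powr r))"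
    if w: "w \<in> space ?PW" and gt: "\<forall>v\<in>?I. w v > w0" for w
  proof -
    have wpos: "w v > 0" if "v \<in> S" for v using gt that S w0 by (auto intro: less_trans)
    have low: "lam * w0\<^sup>2 / real n \<le> \<kappa> w e" if "e \<in> ordered_pairs S" for e
    proof -
      have "fst e \<in> S" "snd e \<in> S" using that by (auto simp: ordered_pairs_def)
      then have "w0 < w (fst e)" "w0 < w (snd e)" using gt S by auto
      then have "w0 * w0 \<le> w (fst e) * w (snd e)" using w0 by (intro mult_mono) auto
      then show ?thesis unfolding \<kappa>_def using lam
        by (intro divide_right_mono) (auto simp: power2_eq_square mult.assoc intro: mult_left_mono)
    qed
    have lowpos: "lam * w0\<^sup>2 / real n > 0" using lam w0 n by simp
    have "(\<Sum>e\<in>ordered_pairs S. - ln (min 1 (\<kappa> w e)))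
        \<le> (\<Sum>e\<in>ordered_pairs S. - ln (min 1 (lam * w0\<^sup>2 / real n)))"
    proof (rule sum_mono)
      fix e assume "e \<in> ordered_pairs S"
      from low[OF this] show "- ln (min 1 (\<kappa> w e)) \<le> - ln (min 1 (lam * w0\<^sup>2 / real n))"
        using lowpos by (simp only: neg_le_iff_le, intro ln_mono) auto
    qed
    also have "\<dots> \<le> (1 - s) * real d" using small by simp
    finally have sum: "(\<Sum>e\<in>ordered_pairs S. - ln (min 1 (\<kappa> w e))) \<le> (1 - s) * real d" .
    have "PU.prob (B w) ^ d \<le> (\<Prod>e\<in>ordered_pairs S. \<kappa> w e powr s)"
      unfolding B_def
    proof (rule measure_all_close_power_le[OF _ S d s _ sum])
      show "\<kappa> w e > 0" if "e \<in> ordered_pairs S" for e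
        using low[OF that] lowpos by linarith
    qed simp
    also have "\<dots> = (\<Prod>e\<in>ordered_pairs S. (lam / real n * w (fst e) * w (snd e)) powr s)"
      by (simp add: \<kappa>_def)
    also have "\<dots> = (lam / real n) powr (s * real (card (ordered_pairs S))) * (\<Prod>v\<in>S. w v powr r)"
      unfolding r_def using lam n wpos by (intro prod_ordered_pairs_powr finS) auto
    finally have "ennreal (PU.prob (B w) ^ d)
        \<le> ennreal ((lam / real n) powr (s * real (card (ordered_pairs S))) * (\<Prod>v\<in>S. w v powr r))"
      by (rule ennreal_leI)
    then show ?thesis
      unfolding slice[OF w] PT.emeasure_eq_measure slice_measure
      by (simp add: ennreal_mult' prod_ennreal)
  qed
  have "emeasure ?G A = emeasure (?PW \<Otimes>\<^sub>M ?PT) (?z -` A \<inter> space (?PW \<Otimes>\<^sub>M ?PT))"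
    by (subst G_eq) (rule emeasure_distr[OF z_meas setsA])
  also have "\<dots> = (\<integral>\<^sup>+w. emeasure ?PT (Pair w -` (?z -` A \<inter> space (?PW \<Otimes>\<^sub>M ?PT))) \<partial>?PW)"
    by (rule PT.emeasure_pair_measure_alt[OF setsA'])
  also have "\<dots> \<le> (\<integral>\<^sup>+w. ennreal ((lam / real n) powr (s * real (card (ordered_pairs S)))) * (\<Prod>v\<in>S. ennreal (w v powr r)) \<partial>?PW)"
  proof (rule nn_integral_mono_AE)
    have "AE w in ?PW. \<forall>v\<in>?I. w v > w0"
    proof (rule AE_finite_allI)
      fix v assume "v \<in> ?I"
      then show "AE w in ?PW. w v > w0"
        using AE_weight_measure_gt[OF w0 \<beta>] W.prob_space_axioms by (intro AE_PiM_component)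
    qed simp
    with AE_space show "AE w in ?PW. emeasure ?PT (Pair w -` (?z -` A \<inter> space (?PW \<Otimes>\<^sub>M ?PT)))
      \<le> ennreal ((lam / real n) powr (s * real (card (ordered_pairs S)))) * (\<Prod>v\<in>S. ennreal (w v powr r))"
      by eventually_elim (rule slice_le)
  qed
  \<comment> \<open>Vertices outside \<open>S\<close> receive the factor 1, so that the product
    ranges over the whole index set of the product measure.\<close>
  also have "\<dots> = (\<integral>\<^sup>+w. ennreal ((lam / real n) powr (s * real (card (ordered_pairs S)))) *
      (\<Prod>v\<in>?I. if v \<in> S then ennreal (w v powr r) else 1) \<partial>?PW)"
    using S by (intro nn_integral_cong arg_cong2[where f = "(*)"] refl)
      (simp add: prod.If_cases Int_absorb1)
  also have "\<dots> = ennreal ((lam / real n) powr (s * real (card (ordered_pairs S)))) *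
      (\<integral>\<^sup>+w. (\<Prod>v\<in>?I. (if v \<in> S then ennreal (w v powr r) else 1)) \<partial>?PW)"
  proof (rule nn_integral_cmult)
    have sets_W: "sets ?W = sets borel" by (simp add: weight_measure_def)
    have "(\<lambda>w. w v) \<in> borel_measurable ?PW" if "v \<in> ?I" for v
      using measurable_component_singleton[OF that, of "\<lambda>_. ?W"]
      unfolding measurable_cong_sets[OF refl sets_W] .
    then have "(\<lambda>w. if v \<in> S then ennreal (w v powr r) else 1) \<in> borel_measurable ?PW" if "v \<in> ?I" for v
      using that by (cases "v \<in> S") auto
    then show "(\<lambda>w. \<Prod>v\<in>?I. (if v \<in> S then ennreal (w v powr r) else 1)) \<in> borel_measurable ?PW"
      by (rule borel_measurable_prod_ennreal)
  qed
  also have "(\<integral>\<^sup>+w. (\<Prod>v\<in>?I. (if v \<in> S then ennreal (w v powr r) else 1)) \<partial>?PW)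
      = (\<Prod>v\<in>?I. \<integral>\<^sup>+w. (if v \<in> S then ennreal (w powr r) else 1) \<partial>?W)"
    by (rule PW.product_nn_integral_prod[where f = "\<lambda>v w. if v \<in> S then ennreal (w powr r) else 1"])
       (auto simp: weight_measure_def)
  also have "\<dots> = (\<Prod>v\<in>?I. if v \<in> S then \<integral>\<^sup>+w. ennreal (w powr r) \<partial>?W else 1)"
    by (intro prod.cong refl) (simp add: W.emeasure_space_1)
  also have "\<dots> = (\<integral>\<^sup>+w. ennreal (w powr r) \<partial>?W) ^ card S"
    using S by (simp add: prod.If_cases Int_absorb1)
  finally show ?thesis by (simp add: A_def r_def)
qed

text \<open>Linearity over the \<open>k\<close>-sets, whose number is bounded crudely by n^k. The
  condition on the exponent keeps the moment finite, so \<open>enn2real\<close> returns its true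
  value and not the default 0.\<close>

lemma expectation_num_cliques_le:
  fixes lam w0 \<beta> s :: real
  assumes lam: "lam > 0" and w0: "w0 > 0" and \<beta>: "\<beta> > 1" and d: "d > 0" and n: "n > 0"
    and s: "s \<ge> 0" "s * (real k - 1) \<ge> 0" "s * (real k - 1) < \<beta> - 1"
    and small: "real k * (real k - 1) / 2 * (- ln (min 1 (lam * w0\<^sup>2 / real n))) \<le> (1 - s) * real d"
  shows "(\<integral>g. real (num_cliques {..<n} (girg_edges lam n d g) k) \<partial>girg_measure n \<beta> w0 d)
    \<le> real n ^ k * ((lam / real n) powr (s * (real k * (real k - 1) / 2)) *
        enn2real (\<integral>\<^sup>+w. ennreal (w powr (s * (real k - 1))) \<partial>weight_measure \<beta> w0) ^ k)"
proof -
  let ?G = "girg_measure n \<beta> w0 d" and ?\<S> = "{S. S \<subseteq> {..<n} \<and> card S = k}"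
  let ?A = "\<lambda>S. {g \<in> space ?G. clique S (girg_edges lam n d g)}"
  define Q where "Q = (lam / real n) powr (s * (real k * (real k - 1) / 2)) *
        enn2real (\<integral>\<^sup>+w. ennreal (w powr (s * (real k - 1))) \<partial>weight_measure \<beta> w0) ^ k"
  interpret G: prob_space ?G by (rule prob_space_girg_measure[OF w0 \<beta>])
  have fin: "finite ?\<S>" by simp
  have events: "?A S \<in> G.events" if "S \<in> ?\<S>" for S
    using pred_girg_clique[where S = S and n = n and \<beta> = \<beta> and d = d and lam = lam] that by (simp add: pred_def)
  have clique_le: "G.prob (?A S) \<le> Q" if S: "S \<in> ?\<S>" for S
  proof -
    have finS: "finite S" using S finite_subset by blast
    have pairs: "real (card (ordered_pairs S)) = real k * (real k - 1) / 2"
      using card_ordered_pairs[OF finS] S by simp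
    have "emeasure ?G (?A S) \<le> ennreal ((lam / real n) powr (s * (real k * (real k - 1) / 2))) *
      (\<integral>\<^sup>+w. ennreal (w powr (s * (real k - 1))) \<partial>weight_measure \<beta> w0) ^ k"
      using emeasure_girg_clique_le[OF lam w0 \<beta> d s(1) n, of S] S small by (simp add: pairs)
    also have "\<dots> = ennreal Q"
      using weight_moment_finite[OF w0 \<beta> s(2,3)]
      by (simp add: Q_def ennreal_mult' ennreal_power[symmetric] ennreal_enn2real)
    finally show ?thesis
      by (simp add: G.emeasure_eq_measure Q_def)
  qed
  have "(\<integral>g. real (num_cliques {..<n} (girg_edges lam n d g) k) \<partial>?G) = (\<integral>g. (\<Sum>S\<in>?\<S>. indicator (?A S) g) \<partial>?G)"
  proof (rule Bochner_Integration.integral_cong[OF refl])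
    fix g assume g: "g \<in> space ?G"
    have "{S. S \<subseteq> {..<n} \<and> card S = k \<and> clique S (girg_edges lam n d g)}
        = ?\<S> \<inter> {S. clique S (girg_edges lam n d g)}" by auto
    then show "real (num_cliques {..<n} (girg_edges lam n d g) k) = (\<Sum>S\<in>?\<S>. indicator (?A S) g)"
      using fin g by (simp add: num_cliques_def indicator_def sum.If_cases)
  qed
  also have "\<dots> = (\<Sum>S\<in>?\<S>. \<integral>g. indicator (?A S) g \<partial>?G)"
    using events by (intro Bochner_Integration.integral_sum integrable_real_indicator) (auto simp: G.emeasure_eq_measure)
  also have "\<dots> = (\<Sum>S\<in>?\<S>. G.prob (?A S))"
    by (intro sum.cong refl) (simp add: Int_absorb2)
  also have "\<dots> \<le> (\<Sum>S\<in>?\<S>. Q)" by (intro sum_mono clique_le)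
  also have "\<dots> = real (n choose k) * Q" using n_subsets[of "{..<n}" k] by simp
  also have "\<dots> \<le> real n ^ k * Q"
  proof (rule mult_right_mono)
    have "n choose k \<le> n ^ k" by (cases "k \<le> n") (auto simp: binomial_le_pow binomial_eq_0)
    then show "real (n choose k) \<le> real n ^ k" by (metis of_nat_le_iff of_nat_power)
  qed (simp add: Q_def)
  finally show ?thesis by (simp add: Q_def)
qed

section \<open>Asymptotics of the expected number of cliques\<close>

lemma eventually_log_scale_small:
  fixes d :: "nat \<Rightarrow> nat"
  assumes d: "(\<lambda>n. real (d n)) \<in> \<omega>(\<lambda>n. ln (real n))" and "a > 0" "c > 0" "b \<ge> 0"
  shows "\<forall>\<^sub>F n in sequentially. d n > 0 \<and> b * (- ln (min 1 (a / real n))) \<le> c * real (d n)"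
proof -
  \<comment> \<open>The 2 pays for the bound \<open>2 * ln (real n)\<close> below;
    \<open>b + 1\<close> in place of \<open>b\<close> keeps the denominator positive when
    \<open>b\<close> is 0.\<close>
  define c' where "c' = c / (2 * (b + 1))"
  have c': "c' > 0" "2 * b * c' \<le> c" using assms by (auto simp: c'_def field_simps)
  have "(\<lambda>n. ln (real n)) \<in> o(\<lambda>n. real (d n))" using d by (simp add: smallomega_iff_smallo)
  from landau_o.smallD[OF this c'(1)]
  have "\<forall>\<^sub>F n in sequentially. norm (ln (real n)) \<le> c' * norm (real (d n))" .
  moreover have "\<forall>\<^sub>F n in sequentially. ln (real n) > max 0 (- ln a)"
    using filterlim_compose[OF ln_at_top filterlim_real_sequentially]
    unfolding filterlim_at_top_dense by (rule spec)
  moreover have "\<forall>\<^sub>F n in sequentially. n > (0::nat)" by (rule eventually_gt_at_top)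
  ultimately show ?thesis
  proof eventually_elim
    case (elim n)
    then have dn: "ln (real n) \<le> c' * real (d n)" and pos: "ln (real n) > 0" by auto
    have "c' * real (d n) > 0" using dn pos by linarith
    then have "d n > 0" using c'(1) by (simp add: zero_less_mult_iff)
    moreover have "b * (- ln (min 1 (a / real n))) \<le> c * real (d n)"
    proof -
      \<comment> \<open>The left side is either 0 or ln n - ln a, and - ln a is below ln n by the
        choice of n.\<close>
      have "- ln (min 1 (a / real n)) \<le> 2 * ln (real n)"
        using elim assms(2) by (auto simp: min_def ln_div)
      then have "b * (- ln (min 1 (a / real n))) \<le> b * (2 * (c' * real (d n)))"
        using dn assms(4) by (intro mult_left_mono) auto
      also have "\<dots> = (2 * b * c') * real (d n)" by simp
      also have "\<dots> \<le> c * real (d n)" using c'(2) by (intro mult_right_mono) auto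
      finally show ?thesis .
    qed
    ultimately show ?case by simp
  qed
qed

lemma expectation_num_cliques_tendsto_0:
  fixes lam w0 \<beta> :: real and d :: "nat \<Rightarrow> nat"
  assumes lam: "lam > 0" and w0: "w0 > 0" and \<beta>: "\<beta> > 3"
    and d: "(\<lambda>n. real (d n)) \<in> \<omega>(\<lambda>n. ln (real n))" and k: "k \<ge> 4"
  shows "(\<lambda>n. \<integral>g. real (num_cliques {..<n} (girg_edges lam n (d n) g) k) \<partial>girg_measure n \<beta> w0 (d n))
    \<longlonglongrightarrow> 0"
proof -
  \<comment> \<open>The exponent \<open>s\<close> is chosen so that each weight occurs with power \<open>2 + \<epsilon>\<close>: this moment is
    finite, while the powers of \<open>n\<close> combine to \<open>n powr (- k \<epsilon> / 2)\<close>. The room \<open>s < 1\<close>, which absorbs the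
    dependence between pairs, is available exactly because \<open>k \<ge> 4\<close>.\<close>
  define \<epsilon> where "\<epsilon> = min (1 / 2) ((\<beta> - 3) / 2)"
  define s where "s = (2 + \<epsilon>) / (real k - 1)"
  \<comment> \<open>The cap 1/2 keeps 2 + \<epsilon> below 3, hence below k - 1, so that s < 1;
    halving \<beta> - 3 keeps 2 + \<epsilon> strictly below \<beta> - 1.\<close>
  have \<epsilon>: "\<epsilon> > 0" "\<epsilon> \<le> 1 / 2" "2 + \<epsilon> < \<beta> - 1" using \<beta> by (auto simp: \<epsilon>_def min_def field_simps)
  have k1: "real k - 1 \<ge> 3" using k by simp
  have sk: "s * (real k - 1) = 2 + \<epsilon>" using k1 by (simp add: s_def)
  have s: "s \<ge> 0" "s < 1" using k1 \<epsilon> by (auto simp: s_def field_simps)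
  define M where "M = enn2real (\<integral>\<^sup>+w. ennreal (w powr (2 + \<epsilon>)) \<partial>weight_measure \<beta> w0)"
  define p where "p = real k * (2 + \<epsilon>) / 2"
  define C where "C = lam powr p * M ^ k"
  define q where "q = real k * \<epsilon> / 2"
  have q: "q > 0" using k \<epsilon> by (simp add: q_def)
  \<comment> \<open>\<open>p\<close> is the exponent of 1/n contributed by the pairs: the part
    \<open>k\<close> offsets the choice of the vertices, and \<open>q\<close> remains as the rate of
    decay.\<close>
  have pq: "p = real k + q" by (simp add: p_def q_def algebra_simps)
  have bound: "\<forall>\<^sub>F n in sequentially.
      (\<integral>g. real (num_cliques {..<n} (girg_edges lam n (d n) g) k) \<partial>girg_measure n \<beta> w0 (d n)) \<le> C * real n powr (- q)"
  proof -
    have "\<forall>\<^sub>F n in sequentially. d n > 0 \<and>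
        real k * (real k - 1) / 2 * (- ln (min 1 (lam * w0\<^sup>2 / real n))) \<le> (1 - s) * real (d n)"
      using k1 s lam w0 by (intro eventually_log_scale_small[OF d]) auto
    then show ?thesis
      using eventually_gt_at_top[of 0]
    proof eventually_elim
      case (elim n)
      then have n: "n > 0" "d n > 0" by auto
      have "(\<integral>g. real (num_cliques {..<n} (girg_edges lam n (d n) g) k) \<partial>girg_measure n \<beta> w0 (d n))
        \<le> real n ^ k * ((lam / real n) powr (s * (real k * (real k - 1) / 2)) * M ^ k)"
        using expectation_num_cliques_le[OF lam w0 _ n(2,1) s(1), where k = k and \<beta> = \<beta>] elim \<epsilon> \<beta>
        by (simp add: sk M_def)
      also have "s * (real k * (real k - 1) / 2) = p"
      proof -
        have "s * (real k * (real k - 1) / 2) = real k * (s * (real k - 1)) / 2" by simp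
        then show ?thesis by (simp only: sk p_def)
      qed
      also have "real n ^ k * ((lam / real n) powr p * M ^ k) = C * (real n ^ k / real n powr p)"
        using lam by (simp add: C_def powr_divide)
      also have "real n ^ k / real n powr p = real n powr (- q)"
        using n by (simp add: pq powr_add powr_realpow powr_minus field_simps)
      finally show ?case .
    qed
  qed
  have "(\<lambda>n. C * real n powr (- q)) \<longlonglongrightarrow> C * 0"
    using q by (intro tendsto_mult tendsto_const tendsto_neg_powr filterlim_real_sequentially) auto
  then show ?thesis
    by (intro tendsto_sandwich[OF _ bound tendsto_const]) auto
qed

section \<open>From the number of 4-cliques to the clique number\<close>

lemma clique_number_gt_imp_num_cliques:
  assumes "finite V" "clique_number V E > m"
  shows "num_cliques V E (Suc m) \<ge> 1"
proof -
  have fin: "finite {S. S \<subseteq> V \<and> clique S E}"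
    using assms(1) by (auto intro: finite_subset[of _ "Pow V"])
  \<comment> \<open>The empty clique guarantees that the maximum is attained.\<close>
  moreover have "{} \<in> {S. S \<subseteq> V \<and> clique S E}" by simp
  ultimately have "clique_number V E \<in> card ` {S. S \<subseteq> V \<and> clique S E}"
    unfolding clique_number_def by (intro Max_in) auto
  then obtain S where S: "S \<subseteq> V" "clique S E" "card S = clique_number V E" by auto
  with assms(2) have "Suc m \<le> card S" by simp
  \<comment> \<open>Subsets of cliques are cliques, so a largest clique can be trimmed to exactly
    \<open>Suc m\<close> vertices.\<close>
  then obtain S' where "S' \<subseteq> S" "card S' = Suc m" by (rule obtain_subset_with_card_n)
  with S have "S' \<in> {S. S \<subseteq> V \<and> card S = Suc m \<and> clique S E}"
    by (auto simp: clique_def)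
  moreover have "finite {S. S \<subseteq> V \<and> card S = Suc m \<and> clique S E}"
    using assms(1) by (auto intro: finite_subset[of _ "Pow V"])
  ultimately have "card {S. S \<subseteq> V \<and> card S = Suc m \<and> clique S E} > 0"
    unfolding card_gt_0_iff by blast
  then show ?thesis by (simp add: num_cliques_def)
qed

theorem theorem32:
  fixes lam w0 \<beta> :: real and d :: "nat \<Rightarrow> nat"
  assumes "lam > 0" and "w0 > 0" and "\<beta> > 3"
    and "(\<lambda>n. real (d n)) \<in> \<omega>(\<lambda>n. ln (real n))"
  shows "(\<forall>k\<ge>4. (\<lambda>n. \<integral>g. real (num_cliques {..<n} (girg_edges lam n (d n) g) k)
                         \<partial>girg_measure n \<beta> w0 (d n)) \<in> o(\<lambda>_. 1)) \<and>
         (\<lambda>n. measure (girg_measure n \<beta> w0 (d n))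
                {g \<in> space (girg_measure n \<beta> w0 (d n)).
                   clique_number {..<n} (girg_edges lam n (d n) g) \<le> 3}) \<longlonglongrightarrow> 1"
proof (intro conjI allI impI)
  note lim = expectation_num_cliques_tendsto_0[OF assms]
  show "(\<lambda>n. \<integral>g. real (num_cliques {..<n} (girg_edges lam n (d n) g) k)
      \<partial>girg_measure n \<beta> w0 (d n)) \<in> o(\<lambda>_. 1)" if "k \<ge> 4" for k
    using lim[OF that] by (intro smalloI_tendsto) auto
  let ?G = "\<lambda>n. girg_measure n \<beta> w0 (d n)" and ?K = "\<lambda>n g. real (num_cliques {..<n} (girg_edges lam n (d n) g) 4)"
  \<comment> \<open>Markov's inequality in indicator form: whenever the clique number exceeds 3, the
    count of 4-cliques is at least 1 and so dominates the indicator of that event.\<close>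
  have lower: "1 - (\<integral>g. ?K n g \<partial>?G n) \<le> measure (?G n) {g \<in> space (?G n). clique_number {..<n} (girg_edges lam n (d n) g) \<le> 3}"
    (is "_ \<le> measure _ ?A") for n
  proof -
    interpret G: prob_space "?G n" using assms by (intro prob_space_girg_measure) auto
    have A: "?A \<in> G.events" by (rule sets_clique_number_le)
    have int: "integrable (?G n) (?K n)" using assms by (intro integrable_num_cliques) auto
    have "1 - G.prob ?A = G.prob (space (?G n) - ?A)" using G.prob_compl[OF A] by simp
    also have "\<dots> = (\<integral>g. indicator (space (?G n) - ?A) g \<partial>?G n)" by (simp add: Int_absorb2)
    also have "\<dots> \<le> (\<integral>g. ?K n g \<partial>?G n)"
    proof (rule integral_mono)
      show "integrable (?G n) (\<lambda>g. indicator (space (?G n) - ?A) g :: real)"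
        using A by (intro integrable_real_indicator) (auto simp: G.emeasure_eq_measure)
      show "indicator (space (?G n) - ?A) g \<le> ?K n g" for g
        using clique_number_gt_imp_num_cliques[of "{..<n}" 3 "girg_edges lam n (d n) g"]
        by (auto simp: indicator_def)
    qed (rule int)
    finally show ?thesis by simp
  qed
  have upper: "measure (?G n) B \<le> 1" for n B
  proof -
    interpret G: prob_space "?G n" using assms by (intro prob_space_girg_measure) auto
    show ?thesis by simp
  qed
  have "(\<lambda>n. 1 - (\<integral>g. ?K n g \<partial>?G n)) \<longlonglongrightarrow> 1"
    using tendsto_diff[OF tendsto_const[of 1] lim[of 4]] by simp
  then show "(\<lambda>n. measure (?G n) {g \<in> space (?G n). clique_number {..<n} (girg_edges lam n (d n) g) \<le> 3}) \<longlonglongrightarrow> 1"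
    using lower upper
    by (rule tendsto_sandwich[OF always_eventually[OF allI] always_eventually[OF allI] _ tendsto_const, rotated 2])
qed

end
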